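(* For all $n\in\mathbb{N}$: for $d=1,2$ we have $$ a_{2n+d-1}=2^n C_{n,3,d}, $$ and for $d=1,2,3$ we have $$ b_{3n+d-1}=C_{n,4,d}. $$
   Context: $\mathbb{N}$ denotes the nonnegative integers. The $(k,d)$-Catalan number is $C_{n,k,d}=\frac{d}{(k-1)n+d}\binom{kn+d-1}{n}$. Let $P$ be a convex polygon with $N+2$ vertices drawn with a horizontal edge at the top. Vertices are colored counterclockwise starting at the left endpoint of the top edge; the last vertex is the right endpoint of the top edge. A triangulation of $P$ is a set of chords between vertices of $P$, no two crossing in the interior of $P$, such that all bounded regions are triangles with vertices among those of $P$; it is proper (with respect to a coloring with $c$ colors) if every triangle contains all $c$ colors among its vertices. $a_N$ ($N\ge 0$) is the number of proper triangulations of the $(N+2)$-gon colored cyclically $1,2,1,2,\ldots$ ($c=2$). $b_N$ ($N\ge0$) is the number of proper triangulations of the $(N+2)$-gon colored cyclically $1,2,3,1,2,3,\ldots$ ($c=3$), except that if $N+2\equiv 1\pmod 3$ the last vertex is colored $2$. By convention, a polygon with $2$ vertices is a single edge with exactly one proper triangulation, so $a_0=b_0=1$. *)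

theory Defs
  imports "HOL-Analysis.Analysis"
begin

definition left_turn :: "complex \<Rightarrow> complex \<Rightarrow> complex \<Rightarrow> bool" where
  "left_turn p q r \<longleftrightarrow> 0 < Im (cnj (q - p) * (r - p))"

(* v 0, ..., v (m - 1) are the vertices of a (strictly) convex polygon in counterclockwise order,
   drawn with a horizontal top edge with left endpoint v 0 and right endpoint v (m - 1);
   that all other vertices lie below this edge follows from the left turns (v 0, v i, v (m - 1)).
   The case m = 2 is a single horizontal edge. *)
definition convex_polygon :: "nat \<Rightarrow> (nat \<Rightarrow> complex) \<Rightarrow> bool" where
  "convex_polygon m v \<longleftrightarrow>
     2 \<le> m \<and> Im (v 0) = Im (v (m - 1)) \<and> Re (v 0) < Re (v (m - 1)) \<and>
     (\<forall>i j k. i < j \<longrightarrow> j < k \<longrightarrow> k < m \<longrightarrow> left_turn (v i) (v j) (v k))"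

(* A chord joins two non-adjacent vertices and is encoded by its pair of vertex indices,
   the smaller one first. *)
definition chords :: "nat \<Rightarrow> (nat \<times> nat) set" where
  "chords m = {(i, j). i + 1 < j \<and> j < m \<and> (i, j) \<noteq> (0, m - 1)}"

definition chord_segment :: "(nat \<Rightarrow> complex) \<Rightarrow> nat \<times> nat \<Rightarrow> complex set" where
  "chord_segment v e = closed_segment (v (fst e)) (v (snd e))"

definition drawing :: "nat \<Rightarrow> (nat \<Rightarrow> complex) \<Rightarrow> (nat \<times> nat) set \<Rightarrow> complex set" where
  "drawing m v T =
     (\<Union>i<m. closed_segment (v i) (v (Suc i mod m))) \<union> (\<Union>e\<in>T. chord_segment v e)"

definition bounded_regions :: "nat \<Rightarrow> (nat \<Rightarrow> complex) \<Rightarrow> (nat \<times> nat) set \<Rightarrow> complex set set" where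
  "bounded_regions m v T = {R \<in> components (- drawing m v T). bounded R}"

definition open_triangle :: "(nat \<Rightarrow> complex) \<Rightarrow> nat \<Rightarrow> nat \<Rightarrow> nat \<Rightarrow> complex set" where
  "open_triangle v i j k = interior (convex hull {v i, v j, v k})"

definition triangulation :: "nat \<Rightarrow> (nat \<Rightarrow> complex) \<Rightarrow> (nat \<times> nat) set \<Rightarrow> bool" where
  "triangulation m v T \<longleftrightarrow>
     T \<subseteq> chords m \<and>
     (\<forall>e\<in>T. \<forall>f\<in>T. e \<noteq> f \<longrightarrow>
        chord_segment v e \<inter> chord_segment v f \<inter> interior (convex hull (v ` {..<m})) = {}) \<and>
     (\<forall>R\<in>bounded_regions m v T. \<exists>i<m. \<exists>j<m. \<exists>k<m. R = open_triangle v i j k)"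

definition proper :: "nat \<Rightarrow> (nat \<Rightarrow> complex) \<Rightarrow> nat \<Rightarrow> (nat \<Rightarrow> nat) \<Rightarrow> (nat \<times> nat) set \<Rightarrow> bool" where
  "proper m v c col T \<longleftrightarrow>
     (\<forall>i<m. \<forall>j<m. \<forall>k<m. open_triangle v i j k \<in> bounded_regions m v T \<longrightarrow>
        {1..c} \<subseteq> {col i, col j, col k})"

definition num_proper :: "nat \<Rightarrow> (nat \<Rightarrow> complex) \<Rightarrow> nat \<Rightarrow> (nat \<Rightarrow> nat) \<Rightarrow> nat" where
  "num_proper m v c col = card {T. triangulation m v T \<and> proper m v c col T}"

(* Vertices are numbered from 0, colors from 1. *)
definition color2 :: "nat \<Rightarrow> nat" where
  "color2 i = i mod 2 + 1"

definition color3 :: "nat \<Rightarrow> nat \<Rightarrow> nat" where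
  "color3 m i = (if m mod 3 = 1 \<and> i = m - 1 then 2 else i mod 3 + 1)"

(* The numbers a_N and b_N, computed from a drawing v of the (N + 2)-gon. *)
definition a_num :: "(nat \<Rightarrow> complex) \<Rightarrow> nat \<Rightarrow> nat" where
  "a_num v N = num_proper (N + 2) v 2 color2"

definition b_num :: "(nat \<Rightarrow> complex) \<Rightarrow> nat \<Rightarrow> nat" where
  "b_num v N = num_proper (N + 2) v 3 (color3 (N + 2))"

definition kd_catalan :: "nat \<Rightarrow> nat \<Rightarrow> nat \<Rightarrow> real" where
  "kd_catalan n k d =
     real d / ((real k - 1) * real n + real d) * real ((k * n + d - 1) choose n)"

(* Every polygon size is realized, so quantifying over drawings is not vacuous. *)
lemma convex_polygon_exists:
  assumes "2 \<le> m"
  shows "\<exists>v. convex_polygon m v"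
proof -
  define x where "x i = 2 * real i - (real m - 1)" for i
  define v where "v i = Complex (x i) ((x i)\<^sup>2)" for i
  have "left_turn (v i) (v j) (v k)" if "i < j" "j < k" for i j k
  proof -
    have "Im (cnj (v j - v i) * (v k - v i)) = (x j - x i) * (x k - x i) * (x k - x j)"
      by (simp add: v_def algebra_simps power2_eq_square)
    also have "\<dots> > 0"
      using that by (intro mult_pos_pos) (simp_all add: x_def)
    finally show ?thesis
      by (simp add: left_turn_def)
  qed
  moreover have "x (m - 1) = - x 0" "x 0 < x (m - 1)"
    using assms by (simp_all add: x_def of_nat_diff)
  ultimately have "convex_polygon m v"
    using assms by (simp add: convex_polygon_def v_def)
  then show ?thesis
    by blast
qed

(* The convention that a single edge has exactly one proper triangulation (the empty one)
   is an instance of the general definition. *)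
lemma num_proper_2: "num_proper 2 v c col = 1"
proof -
  have ch: "chords 2 = {}"
    by (auto simp: chords_def)
  have "{..<2::nat} = {0, 1}"
    by auto
  then have dr: "drawing 2 v {} = closed_segment (v 0) (v 1)"
    by (auto simp: drawing_def closed_segment_commute)
  have conn: "connected (- closed_segment (v 0) (v 1))"
    by (rule connected_complement_bounded_convex) (auto intro: bounded_closed_segment)
  have "\<not> bounded (- closed_segment (v 0) (v 1))"
    by (metis bounded_closed_segment cobounded_imp_unbounded double_compl)
  then have br: "bounded_regions 2 v {} = {}"
    unfolding bounded_regions_def dr using conn
    by (metis (mono_tags, lifting) bounded_empty components_eq_sing_iff empty_Collect_eq singletonD)
  have "{T. triangulation 2 v T \<and> proper 2 v c col T} = {{}}"
    using ch br by (auto simp: triangulation_def proper_def)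
  then show ?thesis
    by (simp add: num_proper_def)
qed

end

theory Submission
  imports Defs
begin

text \<open>
  The plan is to replace drawings by combinatorics, to count by a recursion, and to recognize the
  generating functions.

  \<^emph>\<open>From drawings to index sets.\<close> Together with the sides of the polygon, the chords of a
  triangulation form a set of pairs \<open>(a, b)\<close>, \<open>a < b\<close>, built recursively: the side \<open>(0, m - 1)\<close>
  belongs to one triangle \<open>(0, k, m - 1)\<close>, which leaves a triangulation on \<open>0, \<dots>, k\<close> and one on
  \<open>k, \<dots>, m - 1\<close> (predicate \<open>triang\<close>). If an edge set has this form, its triangles are exactly
  the bounded regions of the drawing: the half planes bounded by the edges show that the triangles
  cover the polygon, and that they meet neither each other nor the drawing, so they are the
  components of its complement besides the outside (lemma \<open>triang_components\<close>). Conversely, let all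
  bounded regions of a noncrossing chord set be triangles. It is contained in a recursively built
  set; a chord missing from it would run inside one bounded region, an open triangle which then has
  both ends of that chord as corners. But a side of a triangle is not inside the triangle
  (lemma \<open>triangulation_imp_triang\<close>).

  \<^emph>\<open>Counting.\<close> The choice of the apex \<open>k\<close> gives the recursion \<open>P i j = (\<Sum>k. P i k * P k j)\<close>
  over the apices for which the triangle \<open>(i, k, j)\<close> has all colors.

  \<^emph>\<open>Generating functions.\<close> With two colors, let \<open>D\<close> count the polygons whose two top vertices have
  different colors and \<open>E\<close> those with equal ones. An apex of \<open>E\<close> has the other color, so
  \<open>E = D\<^sup>2\<close>; every apex is admissible for \<open>D\<close> and yields one part of each kind, so
  \<open>D = 1 + 2 x D E = 1 + 2 x D\<^sup>3\<close>. With three colors in cyclic order the color of the apex is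
  determined by the two others; let \<open>X\<close> count the polygons with \<open>3 n + 2\<close> vertices and \<open>Y\<close> those with
  \<open>3 n + 3\<close>. Then \<open>Y = X\<^sup>2\<close> and \<open>X = 1 + x Y\<^sup>2 = 1 + x X\<^sup>4\<close>. For \<open>3 n + 4\<close> vertices, with the last
  one recolored, splitting off the top triangle repeatedly shows that the count is \<open>X\<^sup>3\<close>
  (lemma \<open>num_triang_rainbow_last_0\<close>).

  Finally, if \<open>F = 1 + t x F\<^sup>k\<close>, then \<open>F\<^sup>d\<^sup>+\<^sup>1 = F\<^sup>d + t x F\<^sup>d\<^sup>+\<^sup>k\<close>. The closed form of the \<open>(k, d)\<close>-Catalan
  numbers satisfies the same recurrence, so for positive \<open>d\<close> the coefficient of \<open>x\<^sup>n\<close> in \<open>F\<^sup>d\<close>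
  is \<open>t\<^sup>n C\<close>, where \<open>C\<close> is the \<open>(k, d)\<close>-Catalan number of \<open>n\<close> (lemma \<open>fps_power_nth_kd_catalan\<close>).
\<close>

section \<open>Triangulations as sets of index pairs\<close>

text \<open>
  One of the two possible interleavings of the end points. Sets of edges are tested in both
  orders, so the asymmetry does not matter there.
\<close>
definition crossing :: "nat \<times> nat \<Rightarrow> nat \<times> nat \<Rightarrow> bool" where
  "crossing e f \<longleftrightarrow> fst e < fst f \<and> fst f < snd e \<and> snd e < snd f"

definition noncrossing :: "(nat \<times> nat) set \<Rightarrow> bool" where
  "noncrossing E \<longleftrightarrow> (\<forall>e\<in>E. \<forall>f\<in>E. \<not> crossing e f)"

text \<open>
  The members are pairs of vertex indices, sides included; \<open>ok i k j\<close> is the condition imposed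
  on the triangle with corners \<open>i < k < j\<close>. Keeping the sides in the set makes the two parts of
  a triangulation objects of the same kind.
\<close>
inductive triang :: "(nat \<Rightarrow> nat \<Rightarrow> nat \<Rightarrow> bool) \<Rightarrow> nat \<Rightarrow> nat \<Rightarrow> (nat \<times> nat) set \<Rightarrow> bool"
  for ok where
  edge: "triang ok i (Suc i) {(i, Suc i)}"
| glue: "\<lbrakk>triang ok i k A; triang ok k j B; ok i k j\<rbrakk>
          \<Longrightarrow> triang ok i j (insert (i, j) (A \<union> B))"

definition faces :: "(nat \<times> nat) set \<Rightarrow> (nat \<times> nat \<times> nat) set" where
  "faces E = {(a, b, c). (a, b) \<in> E \<and> (b, c) \<in> E \<and> (a, c) \<in> E}"

lemma triang_less: "triang ok i j E \<Longrightarrow> i < j"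
  by (induction rule: triang.induct) auto

lemma triang_range:
  assumes "triang ok i j E" "(a, b) \<in> E"
  shows "i \<le> a \<and> a < b \<and> b \<le> j"
  using assms
proof (induction arbitrary: a b rule: triang.induct)
  case (glue i k A j B)
  then show ?case
    using triang_less[OF glue(1)] triang_less[OF glue(2)] by fastforce
qed auto

lemma triang_edge: "triang ok i j E \<Longrightarrow> (i, j) \<in> E"
  by (induction rule: triang.induct) auto

lemma triang_sides:
  assumes "triang ok i j E" "i \<le> l" "l < j"
  shows "(l, Suc l) \<in> E"
  using assms
proof (induction rule: triang.induct)
  case (glue i k A j B)
  then show ?case by (cases "l < k") auto
qed auto

lemma triang_noncrossing: "triang ok i j E \<Longrightarrow> noncrossing E"
proof (induction rule: triang.induct)
  case (glue i k A j B)
  have A: "i \<le> fst e \<and> fst e < snd e \<and> snd e \<le> k" if "e \<in> A" for e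
    using triang_range[OF glue(1), of "fst e" "snd e"] that by simp
  have B: "k \<le> fst e \<and> fst e < snd e \<and> snd e \<le> j" if "e \<in> B" for e
    using triang_range[OF glue(2), of "fst e" "snd e"] that by simp
  show ?case
    unfolding noncrossing_def
  proof (intro ballI)
    fix e f assume "e \<in> insert (i, j) (A \<union> B)" "f \<in> insert (i, j) (A \<union> B)"
    then consider "e \<in> A" "f \<in> A" | "e \<in> B" "f \<in> B" | "e \<in> A" "f \<in> B" | "e \<in> B" "f \<in> A"
      | "e = (i, j)" "f \<in> A \<union> B" | "f = (i, j)"
      by blast
    then show "\<not> crossing e f"
    proof cases
      case 3
      then show ?thesis
        using A[of e] B[of f] by (auto simp: crossing_def)
    next
      case 4
      then show ?thesis
        using A[of f] B[of e] by (auto simp: crossing_def)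
    next
      case 5
      then show ?thesis
        using A[of f] B[of f] triang_less[OF glue(1)] triang_less[OF glue(2)]
        by (auto simp: crossing_def)
    next
      case 6
      then show ?thesis
        using \<open>e \<in> insert (i, j) (A \<union> B)\<close> A[of e] B[of e] triang_less[OF glue(1)]
        by (auto simp: crossing_def)
    qed (use glue.IH in \<open>auto simp: noncrossing_def\<close>)
  qed
qed (simp add: noncrossing_def crossing_def)

text \<open>
  The apex over \<open>(i, j)\<close> is the far end of the longest edge at \<open>i\<close> other than \<open>(i, j)\<close>, and
  \<open>i + 1\<close> if there is none. No edge then crosses a side of the new triangle, so that
  the edges split into those of the two smaller polygons.
\<close>
lemma noncrossing_extends_to_triang:
  assumes "i < j" "noncrossing E" "\<And>a b. (a, b) \<in> E \<Longrightarrow> i \<le> a \<and> a < b \<and> b \<le> j"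
  shows "\<exists>T. triang (\<lambda>_ _ _. True) i j T \<and> E \<subseteq> T"
  using assms
proof (induction "j - i" arbitrary: i j E rule: less_induct)
  case less
  show ?case
  proof (cases "j = Suc i")
    case True
    then have "E \<subseteq> {(i, Suc i)}"
      using less.prems(3) by force
    with True show ?thesis
      by (metis triang.edge)
  next
    case False
    define K where "K = insert (Suc i) {k. (i, k) \<in> E \<and> k < j}"
    define k where "k = Max K"
    have fin: "finite K"
      unfolding K_def by (auto intro: finite_subset[of _ "{..<j}"])
    have "k \<in> K"
      unfolding k_def by (rule Max_in) (auto simp: fin, auto simp: K_def)
    then have ik: "i < k" "k < j"
      using less.prems False by (auto simp: K_def)
    have top: "b \<le> k" if "(i, b) \<in> E" "b < j" for b
      unfolding k_def by (rule Max_ge[OF fin]) (use that in \<open>auto simp: K_def\<close>)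
    have split: "b \<le> k \<or> k \<le> a \<or> (a, b) = (i, j)" if ab: "(a, b) \<in> E" for a b
    proof (rule ccontr)
      assume *: "\<not> ?thesis"
      have r: "i \<le> a" "a < b" "b \<le> j"
        using less.prems(3)[OF ab] by auto
      show False
      proof (cases "a = i")
        case True
        then show False
          using top[of b] ab r * by force
      next
        case False
        then have "(i, k) \<in> E"
          using \<open>k \<in> K\<close> * r by (auto simp: K_def)
        then show False
          using less.prems(2) ab False r * unfolding noncrossing_def crossing_def by force
      qed
    qed
    let ?A = "{(a, b) \<in> E. b \<le> k}" and ?B = "{(a, b) \<in> E. k \<le> a}"
    have "\<exists>T. triang (\<lambda>_ _ _. True) i k T \<and> ?A \<subseteq> T"
      by (rule less.hyps) (use ik less.prems in \<open>auto simp: noncrossing_def\<close>)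
    then obtain A where A: "triang (\<lambda>_ _ _. True) i k A" "?A \<subseteq> A"
      by blast
    have "\<exists>T. triang (\<lambda>_ _ _. True) k j T \<and> ?B \<subseteq> T"
      by (rule less.hyps) (use ik less.prems in \<open>auto simp: noncrossing_def\<close>)
    then obtain B where B: "triang (\<lambda>_ _ _. True) k j B" "?B \<subseteq> B"
      by blast
    have "E \<subseteq> insert (i, j) (A \<union> B)"
      using split A(2) B(2) by fast
    with triang.glue[OF A(1) B(1)] show ?thesis
      by blast
  qed
qed

text \<open>
  An index triangle that uses edges of both parts must use \<open>(i, j)\<close> as its longest edge, and then
  its apex lies in both index ranges.
\<close>
lemma faces_glue:
  assumes "triang ok i k A" "triang ok' k j B"
  shows "faces (insert (i, j) (A \<union> B)) = insert (i, k, j) (faces A \<union> faces B)"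
proof -
  note A = triang_range[OF assms(1)] and B = triang_range[OF assms(2)]
  note less = triang_less[OF assms(1)] triang_less[OF assms(2)]
  have "(a, b, c) \<in> insert (i, k, j) (faces A \<union> faces B)"
    if "(a, b, c) \<in> faces (insert (i, j) (A \<union> B))" for a b c
  proof -
    have *: "(a, b) \<in> insert (i, j) (A \<union> B)" "(b, c) \<in> insert (i, j) (A \<union> B)"
        "(a, c) \<in> insert (i, j) (A \<union> B)"
      using that by (auto simp: faces_def)
    have "a < b" "b < c"
      using *(1,2) A B less by fastforce+
    consider "(a, c) = (i, j)" | "(a, c) \<in> A" | "(a, c) \<in> B"
      using *(3) by blast
    then show ?thesis
    proof cases
      case 1
      then have "(a, b) \<in> A \<union> B" "(b, c) \<in> A \<union> B"
        using * \<open>a < b\<close> \<open>b < c\<close> by auto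
      then have "b = k"
        using 1 A B less by fastforce
      then show ?thesis
        using 1 by simp
    next
      case 2
      then have "(a, b) \<in> A" "(b, c) \<in> A"
        using * \<open>a < b\<close> \<open>b < c\<close> A[OF 2] A B less by fastforce+
      with 2 show ?thesis by (simp add: faces_def)
    next
      case 3
      then have "(a, b) \<in> B" "(b, c) \<in> B"
        using * \<open>a < b\<close> \<open>b < c\<close> B[OF 3] A B less by fastforce+
      with 3 show ?thesis by (simp add: faces_def)
    qed
  qed
  moreover have "insert (i, k, j) (faces A \<union> faces B) \<subseteq> faces (insert (i, j) (A \<union> B))"
    using triang_edge[OF assms(1)] triang_edge[OF assms(2)] by (auto simp: faces_def)
  ultimately show ?thesis
    by auto
qed

lemma faces_edge [simp]: "faces {(i, Suc i)} = {}"
  by (auto simp: faces_def)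

text \<open>
  The condition on triangles is global: it can be imposed while building a triangulation or
  checked afterwards on all its faces.
\<close>
lemma triang_iff_faces:
  "triang ok i j E \<longleftrightarrow> triang (\<lambda>_ _ _. True) i j E \<and> (\<forall>(a, b, c)\<in>faces E. ok a b c)"
proof
  show "triang ok i j E \<Longrightarrow> triang (\<lambda>_ _ _. True) i j E \<and> (\<forall>(a, b, c)\<in>faces E. ok a b c)"
    by (induction rule: triang.induct) (auto intro: triang.intros simp: faces_glue)
  have "triang ok i j E" if "triang (\<lambda>_ _ _. True) i j E" "\<forall>(a, b, c)\<in>faces E. ok a b c"
    using that by (induction rule: triang.induct) (auto intro: triang.intros simp: faces_glue)
  then show "triang (\<lambda>_ _ _. True) i j E \<and> (\<forall>(a, b, c)\<in>faces E. ok a b c) \<Longrightarrow> triang ok i j E"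
    by blast
qed

function num_triang :: "(nat \<Rightarrow> nat \<Rightarrow> nat \<Rightarrow> bool) \<Rightarrow> nat \<Rightarrow> nat \<Rightarrow> nat" where
  "num_triang ok i j =
     (if j = Suc i then 1
      else \<Sum>k | i < k \<and> k < j \<and> ok i k j. num_triang ok i k * num_triang ok k j)"
  by auto
termination by (relation "Wellfounded.measure (\<lambda>(ok, i, j). j - i)") auto
declare num_triang.simps [simp del]

lemma num_triang_edge [simp]: "num_triang ok i (Suc i) = 1"
  by (simp add: num_triang.simps)

lemma num_triang_rec:
  "j \<noteq> Suc i \<Longrightarrow>
    num_triang ok i j = (\<Sum>k | i < k \<and> k < j \<and> ok i k j. num_triang ok i k * num_triang ok k j)"
  by (subst num_triang.simps) simp

text \<open>
  A triangulation determines the apex, which is the largest \<open>k < j\<close> with an edge \<open>(i, k)\<close>, and its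
  two parts, which consist of the edges on either side of the apex.
\<close>
lemma card_triang: "finite {E. triang ok i j E} \<and> card {E. triang ok i j E} = num_triang ok i j"
proof (induction ok i j rule: num_triang.induct)
  case (1 ok i j)
  show ?case
  proof (cases "j = Suc i")
    case True
    have "E = {(i, Suc i)}" if "triang ok i (Suc i) E" for E
      using that
    proof cases
      case (glue k A B)
      then show ?thesis
        using triang_less[OF glue(2)] triang_less[OF glue(3)] by simp
    qed simp
    then have "{E. triang ok i j E} = {{(i, Suc i)}}"
      using True triang.edge by auto
    with True show ?thesis by simp
  next
    case False
    define S where "S = (\<lambda>i k. {E. triang ok i k E})"
    define K where "K = {k. i < k \<and> k < j \<and> ok i k j}"
    define g where "g = (\<lambda>(A :: (nat \<times> nat) set, B). insert (i, j) (A \<union> B))"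
    have finK: "finite K"
      by (auto simp: K_def intro: finite_subset[of _ "{..<j}"])
    have IH: "finite (S i k)" "card (S i k) = num_triang ok i k"
        "finite (S k j)" "card (S k j) = num_triang ok k j" if "k \<in> K" for k
      using 1[OF False, of k] that by (auto simp: S_def K_def)
    have eq: "S i j = (\<Union>k\<in>K. g ` (S i k \<times> S k j))"
    proof (intro equalityI subsetI)
      fix E assume "E \<in> S i j"
      then have "triang ok i j E"
        by (simp add: S_def)
      then show "E \<in> (\<Union>k\<in>K. g ` (S i k \<times> S k j))"
      proof cases
        case (glue k A B)
        then have "k \<in> K"
          using triang_less by (auto simp: K_def)
        moreover have "E = g (A, B)" "A \<in> S i k" "B \<in> S k j"
          using glue by (auto simp: g_def S_def)
        ultimately show ?thesis by blast
      qed (use False in simp)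
    qed (auto simp: S_def g_def K_def intro: triang.glue)
    have A_range: "i \<le> a \<and> a < b \<and> b \<le> k" if "A \<in> S i k" "(a, b) \<in> A" for A k a b
      using triang_range[of ok i k A] that by (simp add: S_def)
    have B_range: "k \<le> a \<and> a < b \<and> b \<le> j" if "B \<in> S k j" "(a, b) \<in> B" for B k a b
      using triang_range[of ok k j B] that by (simp add: S_def)
    have left: "{e \<in> g (A, B). snd e \<le> k} = A" and right: "{e \<in> g (A, B). k \<le> fst e} = B"
      if k: "k \<in> K" and A: "A \<in> S i k" and B: "B \<in> S k j" for k A B
    proof -
      have "i < k" "k < j"
        using k by (auto simp: K_def)
      then show "{e \<in> g (A, B). snd e \<le> k} = A" "{e \<in> g (A, B). k \<le> fst e} = B"
        unfolding g_def by (auto dest: A_range[OF A] B_range[OF B])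
    qed
    have inj: "inj_on g (S i k \<times> S k j)" if "k \<in> K" for k
    proof (rule inj_onI, clarify)
      fix A B A' B'
      assume S: "A \<in> S i k" "B \<in> S k j" "A' \<in> S i k" "B' \<in> S k j" and eq: "g (A, B) = g (A', B')"
      show "A = A' \<and> B = B'"
        using left[OF that S(1,2)] left[OF that S(3,4)] right[OF that S(1,2)] right[OF that S(3,4)]
        unfolding eq by simp
    qed
    have spoke: "l \<le> k" if E: "E \<in> g ` (S i k \<times> S k j)" and il: "(i, l) \<in> E" "k \<in> K" "l < j" for k l E
    proof -
      obtain A B where AB: "A \<in> S i k" "B \<in> S k j" "E = g (A, B)"
        using E by auto
      have "i < k"
        using il by (simp add: K_def)
      then show ?thesis
        using il AB A_range[OF AB(1), of i l] B_range[OF AB(2), of i l] by (auto simp: g_def)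
    qed
    have base: "(i, k) \<in> E" if "E \<in> g ` (S i k \<times> S k j)" for k E
      using that triang_edge[of ok i k] by (auto simp: g_def S_def)
    have disj: "g ` (S i k \<times> S k j) \<inter> g ` (S i l \<times> S l j) = {}" if "k \<in> K" "l \<in> K" "k \<noteq> l" for k l
    proof (rule ccontr)
      assume "\<not> ?thesis"
      then obtain E where E: "E \<in> g ` (S i k \<times> S k j)" "E \<in> g ` (S i l \<times> S l j)"
        by blast
      have "l \<le> k" "k \<le> l"
        using spoke[OF E(1) base[OF E(2)]] spoke[OF E(2) base[OF E(1)]] that by (auto simp: K_def)
      with that show False by simp
    qed
    have "card (S i j) = (\<Sum>k\<in>K. card (g ` (S i k \<times> S k j)))"
      unfolding eq by (rule card_UN_disjoint) (use finK IH disj in auto)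
    also have "\<dots> = (\<Sum>k\<in>K. num_triang ok i k * num_triang ok k j)"
      by (rule sum.cong) (auto simp: card_image inj IH card_cartesian_product)
    also have "\<dots> = num_triang ok i j"
      using False by (simp add: num_triang_rec K_def)
    finally have "card (S i j) = num_triang ok i j" .
    moreover have "finite (S i j)"
      unfolding eq using finK IH by auto
    ultimately show ?thesis
      by (simp add: S_def)
  qed
qed

lemma num_triang_shift:
  assumes "\<And>a b c. \<lbrakk>i \<le> a; a < b; b < c; c \<le> j\<rbrakk> \<Longrightarrow> ok' (a + s) (b + s) (c + s) = ok a b c"
  shows "num_triang ok' (i + s) (j + s) = num_triang ok i j"
  using assms
proof (induction ok i j rule: num_triang.induct)
  case (1 ok i j)
  show ?case
  proof (cases "j = Suc i")
    case False
    have "num_triang ok' (i + s) (j + s) = (\<Sum>k | i + s < k \<and> k < j + s \<and> ok' (i + s) k (j + s).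
            num_triang ok' (i + s) k * num_triang ok' k (j + s))"
      using False by (intro num_triang_rec) simp
    also have "\<dots> = (\<Sum>k | i < k \<and> k < j \<and> ok i k j. num_triang ok i k * num_triang ok k j)"
    proof (rule sum.reindex_bij_witness[of _ "\<lambda>k. k + s" "\<lambda>k. k - s"])
      fix k assume k: "k \<in> {k. i < k \<and> k < j \<and> ok i k j}"
      show "k + s \<in> {k. i + s < k \<and> k < j + s \<and> ok' (i + s) k (j + s)}"
        using k 1(3)[of i k j] by auto
    next
      fix k assume k: "k \<in> {k. i + s < k \<and> k < j + s \<and> ok' (i + s) k (j + s)}"
      then have k': "k - s \<in> {k. i < k \<and> k < j \<and> ok i k j}"
        using 1(3)[of i "k - s" j] by auto
      then show "k - s \<in> {k. i < k \<and> k < j \<and> ok i k j}" .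
      have "num_triang ok' (i + s) (k - s + s) = num_triang ok i (k - s)"
        using k' by (intro 1(1) False 1(3)) auto
      moreover have "num_triang ok' (k - s + s) (j + s) = num_triang ok (k - s) j"
        using k' by (intro 1(2) False 1(3)) auto
      ultimately show "num_triang ok i (k - s) * num_triang ok (k - s) j =
          num_triang ok' (i + s) k * num_triang ok' k (j + s)"
        using k by simp
    qed auto
    also have "\<dots> = num_triang ok i j"
      using False by (simp add: num_triang_rec)
    finally show ?thesis .
  qed simp
qed

text \<open>
  The corners of a face cut the boundary of the polygon into three arcs; an edge that crosses no
  side of the face has both ends on the same arc.
\<close>
lemma edge_on_arc_of_face:
  assumes "noncrossing E" "\<And>a b. (a, b) \<in> E \<Longrightarrow> a < b"
    and "(a, b, c) \<in> faces E" "(d, e) \<in> E"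
  shows "(a \<le> d \<and> e \<le> b) \<or> (b \<le> d \<and> e \<le> c) \<or> ((d \<le> a \<or> c \<le> d) \<and> (e \<le> a \<or> c \<le> e))"
proof -
  have E: "(a, b) \<in> E" "(b, c) \<in> E" "(a, c) \<in> E"
    using assms(3) by (auto simp: faces_def)
  then have lt: "a < b" "b < c" "d < e"
    using assms(2,4) by auto
  have "\<not> crossing (a, b) (d, e)" "\<not> crossing (b, c) (d, e)" "\<not> crossing (d, e) (b, c)"
      "\<not> crossing (a, c) (d, e)" "\<not> crossing (d, e) (a, c)"
    using assms(1,4) E unfolding noncrossing_def by blast+
  then have nc: "\<not> (a < d \<and> d < b \<and> b < e)" "\<not> (b < d \<and> d < c \<and> c < e)"
      "\<not> (d < b \<and> b < e \<and> e < c)" "\<not> (a < d \<and> d < c \<and> c < e)" "\<not> (d < a \<and> a < e \<and> e < c)"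
    by (simp_all add: crossing_def)
  consider "d < a" | "d = a" | "a < d" "d < b" | "d = b" | "b < d" "d < c" | "c \<le> d"
    by linarith
  then show ?thesis
  proof cases
    case 1
    with nc(5) show ?thesis by linarith
  next
    case 2
    with nc(3) lt(1) show ?thesis by linarith
  next
    case 3
    with nc(1) show ?thesis by linarith
  next
    case 4
    with nc(4) lt show ?thesis by linarith
  next
    case 5
    with nc(2) show ?thesis by linarith
  next
    case 6
    with lt(3) show ?thesis by linarith
  qed
qed

lemma face_on_arc_of_face:
  assumes "noncrossing E" "\<And>a b. (a, b) \<in> E \<Longrightarrow> a < b"
    and "(a, b, c) \<in> faces E" "(d, e, h) \<in> faces E" "(a, b, c) \<noteq> (d, e, h)"
  shows "{d, e, h} \<subseteq> {a..b} \<or> {d, e, h} \<subseteq> {b..c} \<or> {d, e, h} \<subseteq> {..a} \<union> {c..}"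
proof -
  have E: "(a, b) \<in> E" "(b, c) \<in> E" "(d, e) \<in> E" "(e, h) \<in> E" "(d, h) \<in> E"
    using assms(3,4) by (auto simp: faces_def)
  have lt: "a < b" "b < c" "d < e" "e < h" "a \<noteq> d \<or> b \<noteq> e \<or> c \<noteq> h"
    using assms(2)[OF E(1)] assms(2)[OF E(2)] assms(2)[OF E(3)] assms(2)[OF E(4)] assms(5) by auto
  note de = edge_on_arc_of_face[OF assms(1,2,3) E(3)] and eh = edge_on_arc_of_face[OF assms(1,2,3) E(4)]
    and dh = edge_on_arc_of_face[OF assms(1,2,3) E(5)]
  have "e \<le> a \<or> c \<le> e" if outer: "d \<le> a \<or> c \<le> d" "h \<le> a \<or> c \<le> h"
  proof (rule ccontr)
    assume "\<not> ?thesis"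
    then have "a < e" "e < c"
      by auto
    then have "d \<le> a" "c \<le> h"
      using outer lt(3,4) by auto
    then have "d = a" "e \<le> b" "b \<le> e" "h = c"
      using de eh \<open>a < e\<close> \<open>e < c\<close> lt(1,2) by auto
    with lt(5) show False by simp
  qed
  with dh show ?thesis
    using lt(3,4) by auto
qed

section \<open>Orientation and triangles in the plane\<close>

text \<open>
  Twice the signed area of the triangle \<open>p\<close>, \<open>q\<close>, \<open>r\<close>. It is affine in each argument; as a function
  of \<open>r\<close> it tells on which side of the line through \<open>p\<close> and \<open>q\<close> a point lies.
\<close>
definition orient :: "complex \<Rightarrow> complex \<Rightarrow> complex \<Rightarrow> real" where
  "orient p q r = Im (cnj (q - p) * (r - p))"

lemma orient_rotate: "orient q r p = orient p q r"
  by (simp add: orient_def algebra_simps)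

lemma orient_swap: "orient q p r = - orient p q r"
  by (simp add: orient_def algebra_simps)

lemma orient_degenerate [simp]: "orient p q p = 0" "orient p q q = 0" "orient p p r = 0"
  by (simp_all add: orient_def algebra_simps)

lemma orient_inner: "orient p q r = (\<i> * (q - p)) \<bullet> r - (\<i> * (q - p)) \<bullet> p"
  by (simp add: orient_def inner_complex_def algebra_simps)

lemma orient_segment:
  "orient p q ((1 - u) *\<^sub>R a + u *\<^sub>R b) = (1 - u) * orient p q a + u * orient p q b"
  by (simp add: orient_inner inner_add_right algebra_simps)

lemma hull_orient_ge:
  assumes "x \<in> convex hull S" "\<And>s. s \<in> S \<Longrightarrow> 0 \<le> orient p q s"
  shows "0 \<le> orient p q x"
proof -
  have "convex hull S \<subseteq> {x. (\<i> * (q - p)) \<bullet> x \<ge> (\<i> * (q - p)) \<bullet> p}"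
    by (rule hull_minimal) (use assms(2) in \<open>auto simp: orient_inner convex_halfspace_ge\<close>)
  then show ?thesis
    using assms(1) by (auto simp: orient_inner)
qed

lemma hull_orient_le:
  assumes "x \<in> convex hull S" "\<And>s. s \<in> S \<Longrightarrow> orient p q s \<le> 0"
  shows "orient p q x \<le> 0"
  using hull_orient_ge[OF assms(1), of q p] assms(2) orient_swap[of q p] by force

lemma interior_orient_pos:
  assumes "p \<noteq> q" "x \<in> interior S" "\<And>y. y \<in> S \<Longrightarrow> 0 \<le> orient p q y"
  shows "0 < orient p q x"
proof -
  have "interior S \<subseteq> interior {y. (\<i> * (q - p)) \<bullet> y \<ge> (\<i> * (q - p)) \<bullet> p}"
    by (rule interior_mono) (use assms(3) in \<open>auto simp: orient_inner\<close>)
  then show ?thesis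
    using assms(1,2) by (auto simp: orient_inner)
qed

lemma interior_orient_neg:
  assumes "p \<noteq> q" "x \<in> interior S" "\<And>y. y \<in> S \<Longrightarrow> orient p q y \<le> 0"
  shows "orient p q x < 0"
  using interior_orient_pos[of q p x S] assms orient_swap[of q p] by force

lemma orient_zero_imp_line:
  assumes "p \<noteq> q" "orient p q x = 0"
  shows "\<exists>u. x = (1 - u) *\<^sub>R p + u *\<^sub>R q"
proof -
  define z where "z = q - p"
  define y where "y = x - p"
  have n: "(Re z)\<^sup>2 + (Im z)\<^sup>2 \<noteq> 0"
    using assms(1) by (auto simp: z_def complex_eq_iff sum_power2_eq_zero_iff)
  have o: "Re z * Im y = Im z * Re y"
    using assms(2) by (simp add: orient_def z_def y_def) algebra
  define u where "u = (Re z * Re y + Im z * Im y) / ((Re z)\<^sup>2 + (Im z)\<^sup>2)"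
  have "y = u *\<^sub>R z"
    using n o unfolding u_def complex_eq_iff
    by (simp add: field_simps power2_eq_square)
  then have "x = (1 - u) *\<^sub>R p + u *\<^sub>R q"
    by (simp add: y_def z_def algebra_simps)
  then show ?thesis ..
qed

lemma orthogonal_imp_rotated:
  fixes a z :: complex
  assumes "z \<noteq> 0" "a \<bullet> z = 0"
  shows "\<exists>t. a = t *\<^sub>R (\<i> * z)"
proof
  have n: "(Re z)\<^sup>2 + (Im z)\<^sup>2 \<noteq> 0"
    using assms(1) by (auto simp: complex_eq_iff sum_power2_eq_zero_iff)
  show "a = ((Im a * Re z - Re a * Im z) / ((Re z)\<^sup>2 + (Im z)\<^sup>2)) *\<^sub>R (\<i> * z)"
    using n assms(2) unfolding complex_eq_iff inner_complex_def
    by (simp add: field_simps power2_eq_square) (algebra)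
qed

text \<open>
  The three areas cut off by \<open>x\<close> are its barycentric coordinates, scaled by the area of the
  triangle.
\<close>
lemma barycentric:
  "orient p q r *\<^sub>R x = orient q r x *\<^sub>R p + orient r p x *\<^sub>R q + orient p q x *\<^sub>R r"
  "orient q r x + orient r p x + orient p q x = orient p q r"
  by (simp_all add: complex_eq_iff orient_def algebra_simps)

lemma barycentric_normalized:
  assumes "0 < orient p q r"
  shows "x = (orient q r x / orient p q r) *\<^sub>R p + (orient r p x / orient p q r) *\<^sub>R q
             + (orient p q x / orient p q r) *\<^sub>R r"
proof -
  have "x = (1 / orient p q r) *\<^sub>R (orient p q r *\<^sub>R x)"
    using assms by simp
  also note barycentric(1)[of p q r x]
  finally show ?thesis
    by (simp add: scaleR_add_right)
qed

lemma mem_triangle_iff: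
  assumes "0 < orient p q r"
  shows "x \<in> convex hull {p, q, r} \<longleftrightarrow> 0 \<le> orient p q x \<and> 0 \<le> orient q r x \<and> 0 \<le> orient r p x"
    (is "_ \<longleftrightarrow> ?R")
proof
  have "0 < orient q r p" "0 < orient r p q"
    using assms orient_rotate by metis+
  with assms show "x \<in> convex hull {p, q, r} \<Longrightarrow> ?R"
    by (auto intro!: hull_orient_ge[of x "{p, q, r}"])
  assume ?R
  then show "x \<in> convex hull {p, q, r}"
    unfolding convex_hull_3 mem_Collect_eq
    using barycentric_normalized[OF assms, of x] barycentric(2)[of q r x p] assms
    by (intro exI[of _ "orient q r x / orient p q r"] exI[of _ "orient r p x / orient p q r"]
        exI[of _ "orient p q x / orient p q r"]) (simp add: add_divide_distrib[symmetric])
qed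

lemma interior_triangle:
  assumes "0 < orient p q r"
  shows "interior (convex hull {p, q, r}) =
    {x. 0 < orient p q x \<and> 0 < orient q r x \<and> 0 < orient r p x}"
proof
  have "p \<noteq> q" "q \<noteq> r" "r \<noteq> p"
    using assms by auto
  then show "interior (convex hull {p, q, r}) \<subseteq>
      {x. 0 < orient p q x \<and> 0 < orient q r x \<and> 0 < orient r p x}"
    by (auto simp: mem_triangle_iff[OF assms] intro: interior_orient_pos[where S = "convex hull {p, q, r}"])
  have "open {x. 0 < orient p q x \<and> 0 < orient q r x \<and> 0 < orient r p x}"
    unfolding orient_def by (intro open_Collect_conj open_Collect_less continuous_intros)
  then show "{x. 0 < orient p q x \<and> 0 < orient q r x \<and> 0 < orient r p x} \<subseteq>
      interior (convex hull {p, q, r})"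
    by (rule interior_maximal[rotated]) (auto simp: mem_triangle_iff[OF assms])
qed

lemma interior_triangle_nonempty:
  assumes "0 < orient p q r"
  shows "interior (convex hull {p, q, r}) \<noteq> {}"
proof -
  have "(1/3) *\<^sub>R (p + q + r) \<in> interior (convex hull {p, q, r})"
    using assms by (simp add: interior_triangle) (simp add: orient_def algebra_simps)
  then show ?thesis by blast
qed

lemma triangle_side:
  assumes "0 < orient p q r" "x \<in> convex hull {p, q, r}" "orient p q x = 0"
  shows "x \<in> closed_segment p q"
proof -
  have "orient q r x + orient r p x = orient p q r"
    using barycentric(2)[of q r x p] assms(3) by simp
  then have "1 - orient r p x / orient p q r = orient q r x / orient p q r"
    using assms(1) by (simp add: field_simps)
  then have "x = (1 - orient r p x / orient p q r) *\<^sub>R p + (orient r p x / orient p q r) *\<^sub>R q"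
    using barycentric_normalized[OF assms(1), of x] assms(3) by simp
  moreover have "0 \<le> orient r p x / orient p q r" "orient r p x / orient p q r \<le> 1"
    using assms mem_triangle_iff[OF assms(1), of x] \<open>orient q r x + orient r p x = orient p q r\<close>
    by auto
  ultimately show ?thesis
    unfolding in_segment by blast
qed

lemma triangle_cases:
  assumes "0 < orient p q r" "x \<in> convex hull {p, q, r}"
  shows "x \<in> interior (convex hull {p, q, r}) \<or> x \<in> closed_segment p q \<or>
         x \<in> closed_segment q r \<or> x \<in> closed_segment p r"
proof -
  have "0 < orient q r p" "0 < orient r p q"
    using assms orient_rotate by metis+
  moreover have "x \<in> convex hull {q, r, p}" "x \<in> convex hull {r, p, q}"
    using assms(2) by (simp_all add: insert_commute)
  ultimately show ?thesis
    using triangle_side[of p q r x] triangle_side[of q r p x] triangle_side[of r p q x] assms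
      mem_triangle_iff[OF assms(1), of x]
    unfolding interior_triangle[OF assms(1)] closed_segment_commute[of p r] mem_Collect_eq
    by (metis order_le_less)
qed

text \<open>
  This is how components are recognized: each member of the family is clopen in the union.
\<close>
lemma components_Union_disjoint_open:
  fixes A :: "'a::topological_space set set"
  assumes A: "\<And>X. X \<in> A \<Longrightarrow> open X \<and> connected X \<and> X \<noteq> {}" and disj: "pairwise disjnt A"
  shows "components (\<Union>A) = A"
proof -
  have comp: "connected_component_set (\<Union>A) x = X" if "X \<in> A" "x \<in> X" for X x
  proof
    let ?C = "connected_component_set (\<Union>A) x"
    show "X \<subseteq> ?C"
      using that A by (intro connected_component_maximal) auto
    have "x \<in> ?C"
      using that by auto
    have "?C \<subseteq> X \<union> \<Union>(A - {X})"
      using connected_component_subset[of "\<Union>A" x] by blast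
    moreover have "X \<inter> \<Union>(A - {X}) \<inter> ?C = {}"
      using disj that unfolding pairwise_def disjnt_def by blast
    ultimately have "X \<inter> ?C = {} \<or> \<Union>(A - {X}) \<inter> ?C = {}"
      using A that by (intro connectedD[OF connected_connected_component]) auto
    then show "?C \<subseteq> X"
      using \<open>x \<in> ?C\<close> that \<open>?C \<subseteq> X \<union> \<Union>(A - {X})\<close> by blast
  qed
  show ?thesis
  proof
    show "components (\<Union>A) \<subseteq> A"
      using comp by (auto simp: components_iff)
    show "A \<subseteq> components (\<Union>A)"
    proof
      fix X assume "X \<in> A"
      then obtain x where "x \<in> X"
        using A by blast
      then show "X \<in> components (\<Union>A)"
        using comp[OF \<open>X \<in> A\<close>] \<open>X \<in> A\<close> unfolding components_iff by blast
    qed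
  qed
qed

section \<open>Vertices, sides and chords of a convex polygon\<close>

locale polygon =
  fixes m :: nat and v :: "nat \<Rightarrow> complex"
  assumes convex_polygon: "convex_polygon m v"
begin

abbreviation hull_polygon :: "complex set" where
  "hull_polygon \<equiv> convex hull (v ` {..<m})"

lemma m_ge_2: "2 \<le> m"
  using convex_polygon by (simp add: convex_polygon_def)

lemma left: "\<lbrakk>i < j; j < k; k < m\<rbrakk> \<Longrightarrow> 0 < orient (v i) (v j) (v k)"
  using convex_polygon unfolding convex_polygon_def left_turn_def orient_def by blast

lemma orient_outside:
  assumes "i < j" "j < m" "k < m" "k < i \<or> j < k"
  shows "0 < orient (v i) (v j) (v k)"
  using assms left[of i j k] left[of k i j] orient_rotate[of "v i" "v j" "v k"] by auto

lemma orient_inside: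
  assumes "i < k" "k < j" "j < m"
  shows "orient (v i) (v j) (v k) < 0"
  using left[of i k j] orient_rotate[of "v j" "v i" "v k"] orient_swap[of "v i" "v j" "v k"] assms
    orient_rotate[of "v i" "v k" "v j"]
  by simp

lemma orient_outside_le:
  assumes "i < j" "j < m" "k < m" "k \<le> i \<or> j \<le> k"
  shows "0 \<le> orient (v i) (v j) (v k)"
  using orient_outside[of i j k] assms by (cases "k = i \<or> k = j") auto

lemma orient_inside_le:
  assumes "i \<le> k" "k \<le> j" "j < m"
  shows "orient (v i) (v j) (v k) \<le> 0"
  using orient_inside[of i k j] assms by (cases "k = i \<or> k = j") auto

lemma orient_zero_iff:
  assumes "i < j" "j < m" "k < m"
  shows "orient (v i) (v j) (v k) = 0 \<longleftrightarrow> k = i \<or> k = j"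
  using orient_outside[of i j k] orient_inside[of i k j] assms
  by (cases "k < i \<or> j < k"; cases "i < k \<and> k < j") auto

lemma v_inj: "\<lbrakk>i < m; j < m; i \<noteq> j\<rbrakk> \<Longrightarrow> v i \<noteq> v j"
proof (induction i j rule: linorder_wlog)
  case (le i j)
  show ?case
  proof (cases "m = 2")
    case True
    then have "i = 0" "j = m - 1"
      using le by auto
    then show ?thesis
      using convex_polygon by (auto simp: convex_polygon_def)
  next
    case False
    have "\<exists>k<m. k \<noteq> i \<and> k \<noteq> j"
    proof (rule ccontr)
      assume "\<not> ?thesis"
      then have "{..<m} \<subseteq> {i, j}" by auto
      then have "card {..<m} \<le> card {i, j}" by (intro card_mono) auto
      then show False using m_ge_2 False le by auto
    qed
    then obtain k where "k < m" "k \<noteq> i" "k \<noteq> j" by blast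
    then show ?thesis
      using orient_zero_iff[of i j k] le by auto
  qed
qed auto

text \<open>
  The ends of \<open>(c, d)\<close> are weakly on one side of the line through \<open>v a\<close> and \<open>v b\<close>, and strictly so
  unless they are \<open>a\<close> or \<open>b\<close>. A convex combination of the two that lies on the line is thus
  one of these shared ends.
\<close>
lemma noncrossing_segments_meet_in_vertices:
  assumes "a < b" "b < m" "c < d" "d < m" "(a, b) \<noteq> (c, d)"
    and "\<not> crossing (a, b) (c, d)" "\<not> crossing (c, d) (a, b)"
    and x: "x \<in> closed_segment (v a) (v b)" "x \<in> closed_segment (v c) (v d)"
  shows "x \<in> v ` ({a, b} \<inter> {c, d})"
proof -
  let ?s = "\<lambda>k. orient (v a) (v b) (v k)"
  obtain w where "x = (1 - w) *\<^sub>R v a + w *\<^sub>R v b"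
    using x(1) by (auto simp: in_segment)
  then have s0: "orient (v a) (v b) x = 0"
    by (simp add: orient_segment)
  obtain u where u: "0 \<le> u" "u \<le> 1" "x = (1 - u) *\<^sub>R v c + u *\<^sub>R v d"
    using x(2) by (auto simp: in_segment)
  then have sum0: "(1 - u) * ?s c + u * ?s d = 0"
    using s0 by (simp add: orient_segment)
  have "(a \<le> c \<and> d \<le> b) \<or> ((c \<le> a \<or> b \<le> c) \<and> (d \<le> a \<or> b \<le> d))"
    using assms(1-7) by (auto simp: crossing_def)
  then have same: "(?s c \<le> 0 \<and> ?s d \<le> 0) \<or> (0 \<le> ?s c \<and> 0 \<le> ?s d)"
    using assms(1-4) orient_inside_le[of a c b] orient_inside_le[of a d b]
      orient_outside_le[of a b c] orient_outside_le[of a b d] by auto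
  have zero: "(1 - u) * ?s c = 0" "u * ?s d = 0"
  proof -
    have "((1 - u) * ?s c \<le> 0 \<and> u * ?s d \<le> 0) \<or> (0 \<le> (1 - u) * ?s c \<and> 0 \<le> u * ?s d)"
      using same u(1,2) by (auto simp: mult_nonneg_nonpos)
    then show "(1 - u) * ?s c = 0" "u * ?s d = 0"
      using sum0 by linarith+
  qed
  have c: "u = 1 \<or> c = a \<or> c = b" and d: "u = 0 \<or> d = a \<or> d = b"
    using zero orient_zero_iff[of a b c] orient_zero_iff[of a b d] assms(1-4) by auto
  consider "u = 0" | "u = 1" | "c = a \<or> c = b" "d = a \<or> d = b"
    using c d by blast
  then show ?thesis
  proof cases
    case 1
    with c u have "x = v c" "c \<in> {a, b} \<inter> {c, d}" by auto
    then show ?thesis by blast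
  next
    case 2
    with d u have "x = v d" "d \<in> {a, b} \<inter> {c, d}" by auto
    then show ?thesis by blast
  qed (use assms in auto)
qed

text \<open>
  The line through \<open>v a\<close> and \<open>v b\<close> separates \<open>v c\<close> from \<open>v d\<close>, and vice versa, so the point where
  the lines meet is strictly inside both segments.
\<close>
lemma crossing_segments_meet:
  assumes "crossing (a, b) (c, d)" "d < m"
  shows "open_segment (v a) (v b) \<inter> open_segment (v c) (v d) \<noteq> {}"
proof -
  have abcd: "a < c" "c < b" "b < d"
    using assms by (auto simp: crossing_def)
  let ?s = "\<lambda>x. orient (v a) (v b) x" and ?t = "\<lambda>x. orient (v c) (v d) x"
  have s: "?s (v c) < 0" "0 < ?s (v d)" and t: "?t (v b) < 0" "0 < ?t (v a)"
    using abcd assms(2) orient_inside orient_outside by auto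
  define w where "w = ?s (v c) / (?s (v c) - ?s (v d))"
  define x where "x = (1 - w) *\<^sub>R v c + w *\<^sub>R v d"
  have w: "0 < w" "w < 1"
    using s by (auto simp: w_def field_simps)
  have "?s x = 0"
    using s unfolding x_def orient_segment w_def by (simp add: field_simps)
  moreover have ab: "v a \<noteq> v b" "v c \<noteq> v d"
    using v_inj abcd assms(2) by auto
  ultimately obtain u where u: "x = (1 - u) *\<^sub>R v a + u *\<^sub>R v b"
    using orient_zero_imp_line by blast
  have "?t x = 0"
    unfolding x_def orient_segment by simp
  then have "(1 - u) * ?t (v a) + u * ?t (v b) = 0"
    unfolding u orient_segment .
  then have "u * (?t (v a) - ?t (v b)) = ?t (v a)"
    by (simp add: algebra_simps)
  then have u_eq: "u = ?t (v a) / (?t (v a) - ?t (v b))"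
    using t by (simp add: field_simps)
  have "0 < u" "u < 1"
    unfolding u_eq using t by (simp_all add: divide_simps)
  then have "x \<in> open_segment (v a) (v b)" "x \<in> open_segment (v c) (v d)"
    using u w x_def ab unfolding in_segment by blast+
  then show ?thesis by blast
qed

text \<open>
  A supporting line of the polygon at an inner point of a chord would contain the chord. But
  there are vertices strictly on both sides of a chord.
\<close>
lemma chord_in_interior:
  assumes "(i, j) \<in> chords m"
  shows "open_segment (v i) (v j) \<subseteq> interior hull_polygon"
proof
  fix x assume x: "x \<in> open_segment (v i) (v j)"
  \<comment> \<open>A vertex on the other side of the chord than the vertex after i.\<close>
  define l where "l = (if i = 0 then m - 1 else 0)"
  have ij: "i + 1 < j" "j < m" and l: "l < m" "l < i \<or> j < l"
    using assms by (auto simp: chords_def l_def)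
  have in_hull: "v k \<in> hull_polygon" if "k < m" for k
    using that by (intro hull_inc) auto
  have seg: "closed_segment (v i) (v j) \<subseteq> hull_polygon"
    using in_hull[of i] in_hull[of j] ij
    by (simp add: segment_convex_hull hull_minimal)
  show "x \<in> interior hull_polygon"
  proof (rule ccontr)
    assume notin: "x \<notin> interior hull_polygon"
    have "convex hull {v i, v (Suc i), v j} \<subseteq> hull_polygon"
      using ij by (intro hull_mono) auto
    then have "interior hull_polygon \<noteq> {}"
      using interior_triangle_nonempty[OF left[of i "Suc i" j]] ij
      by (metis Suc_eq_plus1 interior_mono lessI subset_empty)
    then have "x \<notin> rel_interior hull_polygon"
      using notin by (simp add: rel_interior_nonempty_interior)
    moreover have "x \<in> closure hull_polygon"
      using seg x closure_subset open_closed_segment by blast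
    ultimately obtain a where a: "a \<noteq> 0" "\<And>y. y \<in> closure hull_polygon \<Longrightarrow> a \<bullet> x \<le> a \<bullet> y"
      using supporting_hyperplane_relative_frontier[of hull_polygon x] by (metis convex_convex_hull)
    have a': "a \<bullet> x \<le> a \<bullet> v k" if "k < m" for k
      using a(2) in_hull[OF that] closure_subset by blast
    obtain u where u: "0 < u" "u < 1" "x = (1 - u) *\<^sub>R v i + u *\<^sub>R v j"
      using x by (auto simp: in_segment)
    have "a \<bullet> x = (1 - u) * (a \<bullet> v i) + u * (a \<bullet> v j)"
      by (simp add: u(3) inner_add_right)
    then have eq0: "(1 - u) * (a \<bullet> v i - a \<bullet> x) + u * (a \<bullet> v j - a \<bullet> x) = 0"
      by (simp add: algebra_simps)
    moreover have "0 \<le> (1 - u) * (a \<bullet> v i - a \<bullet> x)" "0 \<le> u * (a \<bullet> v j - a \<bullet> x)"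
      using u a'[of i] a'[of j] ij by auto
    ultimately have "(1 - u) * (a \<bullet> v i - a \<bullet> x) = 0" "u * (a \<bullet> v j - a \<bullet> x) = 0"
      by linarith+
    then have eq: "a \<bullet> v i = a \<bullet> x" "a \<bullet> v j = a \<bullet> x"
      using u by auto
    then have "a \<bullet> (v j - v i) = 0" "v j - v i \<noteq> 0"
      using v_inj[of i j] ij by (auto simp: inner_diff_right)
    then obtain t where t: "a = t *\<^sub>R (\<i> * (v j - v i))"
      using orthogonal_imp_rotated by blast
    have side: "a \<bullet> y - a \<bullet> x = t * orient (v i) (v j) y" for y
    proof -
      have "a \<bullet> y - a \<bullet> x = a \<bullet> y - a \<bullet> v i"
        using eq by simp
      also have "\<dots> = t * orient (v i) (v j) y"
        by (simp only: t orient_inner inner_scaleR_left right_diff_distrib)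
      finally show ?thesis .
    qed
    have "0 \<le> t * orient (v i) (v j) (v (Suc i))" "0 \<le> t * orient (v i) (v j) (v l)"
      using side[of "v (Suc i)"] side[of "v l"] a'[of "Suc i"] a'[of l] ij l by auto
    moreover have "orient (v i) (v j) (v (Suc i)) < 0" "0 < orient (v i) (v j) (v l)"
      using orient_inside[of i "Suc i" j] orient_outside[of i j l] ij l by auto
    ultimately have "t = 0"
      by (simp add: zero_le_mult_iff)
    with t a(1) show False by simp
  qed
qed

text \<open>
  With at least three vertices, the line through the two neighbors of \<open>v i\<close> separates it from all other vertices.
\<close>
lemma vertex_notin_hull_of_others:
  assumes "i < m"
  shows "v i \<notin> convex hull (v ` ({..<m} - {i}))"
proof (cases "m = 2")
  case True
  have "v ` ({..<m} - {i}) \<subseteq> {v (1 - i)}"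
  proof (rule image_subsetI)
    fix k assume "k \<in> {..<m} - {i}"
    then have "k = 1 - i"
      using True assms by (simp, linarith)
    then show "v k \<in> {v (1 - i)}" by simp
  qed
  then have "convex hull (v ` ({..<m} - {i})) \<subseteq> {v (1 - i)}"
    by (rule hull_minimal) simp
  moreover have "1 - i \<noteq> i" "1 - i < m"
    using True by presburger+
  then have "v i \<noteq> v (1 - i)"
    using v_inj[OF assms, of "1 - i"] by simp
  ultimately show ?thesis
    by auto
next
  case False
  then have "3 \<le> m"
    using m_ge_2 by simp
  have "\<exists>p q. 0 < orient p q (v i) \<and> (\<forall>k\<in>{..<m} - {i}. orient p q (v k) \<le> 0)"
  proof -
    consider "i = 0" | "i = m - 1" | "0 < i" "i < m - 1"
      using assms by linarith
    then show ?thesis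
    proof cases
      case 1
      have "0 < orient (v 1) (v (m - 1)) (v i)"
        using orient_outside[of 1 "m - 1" 0] 1 \<open>3 \<le> m\<close> by simp
      moreover have "orient (v 1) (v (m - 1)) (v k) \<le> 0" if "k \<in> {..<m} - {i}" for k
        using that 1 by (intro orient_inside_le) auto
      ultimately show ?thesis by blast
    next
      case 2
      have "0 < orient (v 0) (v (m - 2)) (v i)"
        using orient_outside[of 0 "m - 2" "m - 1"] 2 \<open>3 \<le> m\<close> by simp
      moreover have "orient (v 0) (v (m - 2)) (v k) \<le> 0" if "k \<in> {..<m} - {i}" for k
        using that 2 by (intro orient_inside_le) auto
      ultimately show ?thesis by blast
    next
      case 3
      have "0 < orient (v (i + 1)) (v (i - 1)) (v i)"
        using orient_inside[of "i - 1" i "i + 1"] 3 orient_swap[of "v (i + 1)"] by simp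
      moreover have "orient (v (i + 1)) (v (i - 1)) (v k) \<le> 0" if "k \<in> {..<m} - {i}" for k
      proof -
        have "0 \<le> orient (v (i - 1)) (v (i + 1)) (v k)"
          by (rule orient_outside_le) (use that 3 in \<open>simp, simp, simp, simp, linarith\<close>)
        then show ?thesis
          using orient_swap[of "v (i + 1)"] by simp
      qed
      ultimately show ?thesis by blast
    qed
  qed
  then obtain p q where pq: "0 < orient p q (v i)" "\<forall>k\<in>{..<m} - {i}. orient p q (v k) \<le> 0"
    by blast
  show ?thesis
  proof
    assume "v i \<in> convex hull (v ` ({..<m} - {i}))"
    then have "orient p q (v i) \<le> 0"
      by (rule hull_orient_le) (use pq(2) in auto)
    with pq(1) show False by simp
  qed
qed

lemma vertex_notin_interior: "i < m \<Longrightarrow> v i \<notin> interior hull_polygon"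
proof -
  assume i: "i < m"
  then have "insert (v i) (v ` ({..<m} - {i})) = v ` {..<m}"
    by auto
  then show ?thesis
    using extreme_point_of_convex_hull_insert[OF _ vertex_notin_hull_of_others[OF i]]
      extreme_point_not_in_interior by (metis finite_Diff finite_imageI finite_lessThan)
qed

lemma vertex_in_triangle:
  assumes "v i \<in> convex hull {v a, v b, v c}" "i < m" "a < m" "b < m" "c < m"
  shows "i \<in> {a, b, c}"
proof (rule ccontr)
  assume "i \<notin> {a, b, c}"
  then have "convex hull {v a, v b, v c} \<subseteq> convex hull (v ` ({..<m} - {i}))"
    using assms by (intro hull_mono) auto
  then show False
    using assms(1) vertex_notin_hull_of_others[OF assms(2)] by blast
qed

section \<open>Faces as bounded regions\<close>

definition cell :: "nat \<times> nat \<times> nat \<Rightarrow> complex set" where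
  "cell = (\<lambda>(a, b, c). open_triangle v a b c)"

definition skeleton :: "(nat \<times> nat) set \<Rightarrow> complex set" where
  "skeleton E = (\<Union>e\<in>E. chord_segment v e)"

lemma cell_eq:
  assumes "a < b" "b < c" "c < m"
  shows "cell (a, b, c) = {x. 0 < orient (v a) (v b) x \<and> 0 < orient (v b) (v c) x \<and> 0 < orient (v c) (v a) x}"
  unfolding cell_def open_triangle_def using interior_triangle[OF left[OF assms]] by simp

text \<open>
  The side of the face that faces the arc separates the open face from all vertices on the arc.
\<close>
lemma cell_disjoint_hull:
  assumes abc: "a < b" "b < c" "c < m" and S: "S \<subseteq> {..<m}"
    and arc: "S \<subseteq> {a..b} \<or> S \<subseteq> {b..c} \<or> S \<subseteq> {..a} \<union> {c..}"
  shows "cell (a, b, c) \<inter> convex hull (v ` S) = {}"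
proof -
  have "\<exists>p q. (\<forall>x\<in>cell (a, b, c). 0 < orient p q x) \<and> (\<forall>k\<in>S. orient p q (v k) \<le> 0)"
    using arc
  proof (elim disjE)
    assume "S \<subseteq> {a..b}"
    then have "\<forall>k\<in>S. orient (v a) (v b) (v k) \<le> 0"
      using abc by (intro ballI orient_inside_le) auto
    then show ?thesis
      unfolding cell_eq[OF abc] by blast
  next
    assume "S \<subseteq> {b..c}"
    then have "\<forall>k\<in>S. orient (v b) (v c) (v k) \<le> 0"
      using abc by (intro ballI orient_inside_le) auto
    then show ?thesis
      unfolding cell_eq[OF abc] by blast
  next
    assume *: "S \<subseteq> {..a} \<union> {c..}"
    have "\<forall>k\<in>S. 0 \<le> orient (v a) (v c) (v k)"
      using abc S * by (intro ballI orient_outside_le) auto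
    then have "\<forall>k\<in>S. orient (v c) (v a) (v k) \<le> 0"
      using orient_swap[of "v c" "v a"] by simp
    then show ?thesis
      unfolding cell_eq[OF abc] by blast
  qed
  then obtain p q where pq: "\<And>x. x \<in> cell (a, b, c) \<Longrightarrow> 0 < orient p q x"
      "\<And>k. k \<in> S \<Longrightarrow> orient p q (v k) \<le> 0"
    by blast
  have "orient p q x \<le> 0" if "x \<in> convex hull (v ` S)" for x
    using that by (rule hull_orient_le) (use pq(2) in auto)
  with pq(1) show ?thesis
    by (meson disjoint_iff not_le)
qed

lemma cell_subset: "cell (a, b, c) \<subseteq> convex hull (v ` {a, b, c})"
  by (simp add: cell_def open_triangle_def interior_subset)

lemma chord_segment_eq_hull: "chord_segment v (a, b) = convex hull (v ` {a, b})"
  by (simp add: chord_segment_def segment_convex_hull)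

definition edge_set :: "(nat \<times> nat) set \<Rightarrow> bool" where
  "edge_set E \<longleftrightarrow> E \<subseteq> {(a, b). a < b \<and> b < m}"

lemma edge_setD: "edge_set E \<Longrightarrow> (a, b) \<in> E \<Longrightarrow> a < b \<and> b < m"
  by (auto simp: edge_set_def)

lemma faceD: "edge_set E \<Longrightarrow> (a, b, c) \<in> faces E \<Longrightarrow> a < b \<and> b < c \<and> c < m"
  by (auto simp: edge_set_def faces_def)

lemma cell_disjoint_skeleton:
  assumes "edge_set E" "noncrossing E" "f \<in> faces E"
  shows "cell f \<inter> skeleton E = {}"
proof -
  obtain a b c where f: "f = (a, b, c)"
    by (cases f)
  have "cell (a, b, c) \<inter> convex hull (v ` {d, e}) = {}" if "(d, e) \<in> E" for d e
    by (rule cell_disjoint_hull)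
      (use edge_on_arc_of_face[OF assms(2) _ assms(3)[unfolded f] that] faceD[OF assms(1), of a b c]
        edge_setD[OF assms(1)] that assms(3) f in \<open>fastforce+\<close>)
  then show ?thesis
    unfolding f skeleton_def using chord_segment_eq_hull by fastforce
qed

lemma cells_disjoint:
  assumes "edge_set E" "noncrossing E" "f \<in> faces E" "g \<in> faces E" "f \<noteq> g"
  shows "cell f \<inter> cell g = {}"
proof -
  obtain a b c d e h where f: "f = (a, b, c)" and g: "g = (d, e, h)"
    by (cases f, cases g)
  have "cell (a, b, c) \<inter> convex hull (v ` {d, e, h}) = {}"
  proof (rule cell_disjoint_hull)
    show "{d, e, h} \<subseteq> {a..b} \<or> {d, e, h} \<subseteq> {b..c} \<or> {d, e, h} \<subseteq> {..a} \<union> {c..}"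
      by (rule face_on_arc_of_face[OF assms(2)]) (use assms edge_setD[OF assms(1)] f g in auto)
  qed (use faceD[OF assms(1), of a b c] faceD[OF assms(1), of d e h] assms(3,4) f g in auto)
  then show ?thesis
    using cell_subset f g by blast
qed

text \<open>
  The hypotheses on \<open>x\<close> say that it is in the polygon with vertices \<open>i, \<dots>, j\<close>, described by half
  planes. Crossing the line of one side of the top triangle leads into the half-plane description of
  the corresponding smaller polygon, so no intersection points need to be computed.
  The description degenerates to a line for a polygon with two vertices, which is why the cases below
  ask the smaller polygon to have at least three.
\<close>
lemma triang_covers:
  assumes "triang ok i j E" "Suc i < j" "j < m"
    and "\<And>l. \<lbrakk>i \<le> l; l < j\<rbrakk> \<Longrightarrow> 0 \<le> orient (v l) (v (Suc l)) x" "orient (v i) (v j) x \<le> 0"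
  shows "x \<in> skeleton E \<union> \<Union>(cell ` faces E)"
  using assms
proof (induction rule: triang.induct)
  case (glue i k A j B)
  have ik: "i < k" "k < j"
    using triang_less glue.hyps by auto
  have sub: "skeleton A \<subseteq> skeleton (insert (i, j) (A \<union> B))" "skeleton B \<subseteq> skeleton (insert (i, j) (A \<union> B))"
    by (auto simp: skeleton_def)
  note faces = faces_glue[OF glue.hyps(1,2)]
  consider "Suc i < k" "orient (v i) (v k) x \<le> 0" | "Suc k < j" "orient (v k) (v j) x \<le> 0"
    | "0 \<le> orient (v i) (v k) x" "0 \<le> orient (v k) (v j) x"
    using ik glue.prems(3)[of i] glue.prems(3)[of k]
    by (cases "k = Suc i"; cases "j = Suc k") (auto, linarith+)
  then show ?case
  proof cases
    case 1
    then have "x \<in> skeleton A \<union> \<Union>(cell ` faces A)"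
      using ik glue.prems by (intro glue.IH(1)) auto
    then show ?thesis
      using sub faces by auto
  next
    case 2
    then have "x \<in> skeleton B \<union> \<Union>(cell ` faces B)"
      using ik glue.prems by (intro glue.IH(2)) auto
    then show ?thesis
      using sub faces by auto
  next
    case 3
    have turn: "0 < orient (v i) (v k) (v j)"
      using left ik glue.prems by simp
    have "0 \<le> orient (v j) (v i) x"
      using glue.prems orient_swap[of "v j" "v i"] by simp
    then have "x \<in> convex hull {v i, v k, v j}"
      using 3 mem_triangle_iff[OF turn] by simp
    then have "x \<in> cell (i, k, j) \<or> x \<in> chord_segment v (i, k) \<or> x \<in> chord_segment v (k, j) \<or>
        x \<in> chord_segment v (i, j)"
      using triangle_cases[OF turn] by (auto simp: cell_def open_triangle_def chord_segment_def)
    moreover have "(i, k) \<in> A" "(k, j) \<in> B"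
      using triang_edge glue.hyps by auto
    ultimately show ?thesis
      unfolding faces by (auto simp: skeleton_def)
  qed
qed simp

lemma triang_edge_set: "triang ok 0 (m - 1) E \<Longrightarrow> edge_set E"
  using triang_range[of ok 0 "m - 1" E] m_ge_2 unfolding edge_set_def by fastforce

lemma skeleton_subset_hull: "edge_set E \<Longrightarrow> skeleton E \<subseteq> hull_polygon"
  unfolding skeleton_def
proof (rule UN_least, clarify)
  fix a b x assume "edge_set E" "(a, b) \<in> E" "x \<in> chord_segment v (a, b)"
  then show "x \<in> hull_polygon"
    using edge_setD[of E a b] hull_mono[of "v ` {a, b}" "v ` {..<m}" convex]
    unfolding chord_segment_eq_hull by auto
qed

lemma cells_subset_hull: "edge_set E \<Longrightarrow> f \<in> faces E \<Longrightarrow> cell f \<subseteq> hull_polygon"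
proof (cases f)
  case (fields a b c)
  assume "edge_set E" "f \<in> faces E"
  then have "v ` {a, b, c} \<subseteq> v ` {..<m}"
    using faceD[of E a b c] fields by auto
  then show ?thesis
    using cell_subset[of a b c] hull_mono[of _ _ convex] fields by blast
qed

lemma hull_decomposition:
  assumes "triang ok 0 (m - 1) E"
  shows "hull_polygon = skeleton E \<union> \<Union>(cell ` faces E)"
proof
  note E = triang_edge_set[OF assms]
  show "skeleton E \<union> \<Union>(cell ` faces E) \<subseteq> hull_polygon"
    using skeleton_subset_hull[OF E] cells_subset_hull[OF E] by blast
  show "hull_polygon \<subseteq> skeleton E \<union> \<Union>(cell ` faces E)"
  proof
    fix x assume x: "x \<in> hull_polygon"
    show "x \<in> skeleton E \<union> \<Union>(cell ` faces E)"
    proof (cases "m = 2")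
      case True
      have "{..<m} = {0, 1}"
        using True by auto
      then have "x \<in> chord_segment v (0, m - 1)"
        using x True by (simp add: chord_segment_eq_hull)
      then show ?thesis
        using triang_edge[OF assms] by (auto simp: skeleton_def)
    next
      case False
      have "0 \<le> orient (v l) (v (Suc l)) x" if "l < m - 1" for l
        using x
      proof (rule hull_orient_ge)
        fix s assume "s \<in> v ` {..<m}"
        then show "0 \<le> orient (v l) (v (Suc l)) s"
          using that orient_outside_le[of l "Suc l"] by fastforce
      qed
      moreover have "orient (v 0) (v (m - 1)) x \<le> 0"
        using x by (rule hull_orient_le) (use orient_inside_le[of 0 _ "m - 1"] m_ge_2 in fastforce)
      ultimately show ?thesis
        using False m_ge_2 by (intro triang_covers[OF assms]) auto
    qed
  qed
qed

lemma cell_open_connected: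
  assumes "edge_set E" "f \<in> faces E"
  shows "open (cell f)" "connected (cell f)" "cell f \<noteq> {}"
proof -
  obtain a b c where f: "f = (a, b, c)"
    by (cases f)
  show "open (cell f)" "connected (cell f)"
    by (simp_all add: f cell_def open_triangle_def convex_connected convex_interior)
  show "cell f \<noteq> {}"
    using interior_triangle_nonempty[OF left[of a b c]] faceD[OF assms(1), of a b c] assms(2)
    by (simp add: f cell_def open_triangle_def)
qed

lemma bounded_hull: "bounded hull_polygon"
  by (simp add: bounded_convex_hull finite_imp_bounded)

lemma outside_not_bounded: "\<not> bounded (- hull_polygon)"
  using bounded_hull cobounded_imp_unbounded by (metis double_compl)

text \<open>
  The outside is connected as the complement of a bounded convex set, and the faces are open,
  connected and disjoint; by \<open>hull_decomposition\<close> these sets exhaust the complement of the drawing.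
\<close>
lemma triang_components:
  assumes "triang ok 0 (m - 1) E"
  shows "components (- skeleton E) = insert (- hull_polygon) (cell ` faces E)"
proof -
  note E = triang_edge_set[OF assms] and nc = triang_noncrossing[OF assms]
  let ?A = "insert (- hull_polygon) (cell ` faces E)"
  have "\<Union>(cell ` faces E) \<inter> skeleton E = {}"
    using cell_disjoint_skeleton[OF E nc] by blast
  then have "- skeleton E = - (skeleton E \<union> \<Union>(cell ` faces E)) \<union> \<Union>(cell ` faces E)"
    by blast
  then have "- skeleton E = \<Union>?A"
    unfolding hull_decomposition[OF assms, symmetric] by simp
  also have "components (\<Union>?A) = ?A"
  proof (rule components_Union_disjoint_open)
    fix X assume "X \<in> ?A"
    then show "open X \<and> connected X \<and> X \<noteq> {}"
    proof
      assume X: "X = - hull_polygon"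
      have "closed hull_polygon"
        by (simp add: compact_imp_closed finite_imp_compact_convex_hull)
      moreover have "connected (- hull_polygon)"
        by (rule connected_complement_bounded_convex) (auto simp: bounded_hull)
      ultimately show ?thesis
        using outside_not_bounded unfolding X by (metis bounded_empty open_Compl)
    qed (use cell_open_connected[OF E] in auto)
  next
    show "pairwise disjnt ?A"
      unfolding pairwise_insert
    proof (intro conjI ballI impI)
      show "pairwise disjnt (cell ` faces E)"
        unfolding pairwise_def disjnt_def using cells_disjoint[OF E nc] by blast
    qed (use cells_subset_hull[OF E] in \<open>force simp: disjnt_def\<close>)+
  qed
  finally show ?thesis .
qed

definition sides :: "(nat \<times> nat) set" where
  "sides = insert (0, m - 1) {(i, Suc i) |i. Suc i < m}"

lemma side_or_chord: "a < b \<Longrightarrow> b < m \<Longrightarrow> (a, b) \<in> sides \<or> (a, b) \<in> chords m"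
  by (auto simp: sides_def chords_def)

lemma drawing_eq: "drawing m v T = skeleton (T \<union> sides)"
proof -
  have "(\<Union>i<m. closed_segment (v i) (v (Suc i mod m))) = skeleton sides"
  proof
    show "(\<Union>i<m. closed_segment (v i) (v (Suc i mod m))) \<subseteq> skeleton sides"
    proof (rule UN_least)
      fix i assume "i \<in> {..<m}"
      then consider "Suc i < m" | "i = m - 1"
        by force
      then show "closed_segment (v i) (v (Suc i mod m)) \<subseteq> skeleton sides"
      proof cases
        case 1
        then have "(i, Suc i) \<in> sides"
          by (simp add: sides_def)
        with 1 show ?thesis
          by (force simp: skeleton_def chord_segment_def)
      next
        case 2
        then have "closed_segment (v i) (v (Suc i mod m)) = chord_segment v (0, m - 1)"
          using m_ge_2 by (simp add: chord_segment_def closed_segment_commute)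
        then show ?thesis
          by (auto simp: skeleton_def sides_def)
      qed
    qed
    have "\<exists>i<m. chord_segment v e \<subseteq> closed_segment (v i) (v (Suc i mod m))" if "e \<in> sides" for e
      using that unfolding sides_def
    proof
      assume "e = (0, m - 1)"
      then show ?thesis
        using m_ge_2 by (intro exI[of _ "m - 1"]) (simp add: chord_segment_def closed_segment_commute)
    next
      assume "e \<in> {(i, Suc i) |i. Suc i < m}"
      then obtain i where "e = (i, Suc i)" "Suc i < m"
        by blast
      then show ?thesis
        by (intro exI[of _ i]) (simp add: chord_segment_def)
    qed
    then show "skeleton sides \<subseteq> (\<Union>i<m. closed_segment (v i) (v (Suc i mod m)))"
      unfolding skeleton_def by blast
  qed
  then show ?thesis
    by (auto simp: drawing_def skeleton_def)
qed

lemma bounded_regions_triang: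
  assumes "triang ok 0 (m - 1) (T \<union> sides)"
  shows "bounded_regions m v T = cell ` faces (T \<union> sides)"
proof -
  have "bounded (cell f)" if "f \<in> faces (T \<union> sides)" for f
    using cells_subset_hull[OF triang_edge_set[OF assms] that] bounded_hull bounded_subset by blast
  then show ?thesis
    unfolding bounded_regions_def drawing_eq triang_components[OF assms]
    using outside_not_bounded by auto
qed

lemma edge_set_chords_sides: "T \<subseteq> chords m \<Longrightarrow> edge_set (T \<union> sides)"
  using m_ge_2 by (auto simp: edge_set_def chords_def sides_def)

lemma crossing_imp_chord:
  assumes "crossing e f" "e \<in> chords m \<union> sides" "f \<in> chords m \<union> sides"
  shows "e \<in> chords m" "f \<in> chords m"
  using assms by (cases e; cases f; fastforce simp: crossing_def chords_def sides_def)+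

text \<open>
  Only chords can cross, and crossing chords meet in the interior of the polygon.
\<close>
lemma triangulation_noncrossing:
  assumes "triangulation m v T"
  shows "noncrossing (T \<union> sides)"
  unfolding noncrossing_def
proof (intro ballI notI)
  fix e f assume ef: "e \<in> T \<union> sides" "f \<in> T \<union> sides" and c: "crossing e f"
  have T: "T \<subseteq> chords m"
    using assms by (simp add: triangulation_def)
  have disj: "chords m \<inter> sides = {}"
    by (auto simp: chords_def sides_def)
  have "e \<in> chords m" "f \<in> chords m"
    using crossing_imp_chord[OF c] ef T by auto
  then have "e \<in> T" "f \<in> T"
    using ef disj by auto
  moreover have "e \<noteq> f"
    using c by (auto simp: crossing_def)
  ultimately have empty: "chord_segment v e \<inter> chord_segment v f \<inter> interior hull_polygon = {}"
    using assms unfolding triangulation_def by blast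
  obtain a b c d where [simp]: "e = (a, b)" "f = (c, d)"
    by (cases e, cases f)
  have "open_segment (v a) (v b) \<inter> open_segment (v c) (v d) \<noteq> {}"
    using crossing_segments_meet[of a b c d] c \<open>f \<in> chords m\<close> by (auto simp: chords_def)
  then obtain y where y: "y \<in> open_segment (v a) (v b)" "y \<in> open_segment (v c) (v d)"
    by blast
  have "y \<in> interior hull_polygon"
    using chord_in_interior[of a b] \<open>e \<in> chords m\<close> y(1) by auto
  moreover have "y \<in> chord_segment v e \<inter> chord_segment v f"
    using open_closed_segment[OF y(1)] open_closed_segment[OF y(2)] by (simp add: chord_segment_def)
  ultimately show False
    using empty by blast
qed

text \<open>
  Any triangulation decomposes the polygon into open faces and edges. Faces and chords are
  inside, which leaves the sides.
\<close>
lemma frontier_hull_subset_sides: "frontier hull_polygon \<subseteq> skeleton sides"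
proof
  fix x assume x: "x \<in> frontier hull_polygon"
  obtain E where E: "triang (\<lambda>_ _ _. True) 0 (m - 1) E"
    using noncrossing_extends_to_triang[of 0 "m - 1" "{}"] m_ge_2 by (auto simp: noncrossing_def)
  have "closed hull_polygon"
    by (simp add: compact_imp_closed finite_imp_compact_convex_hull)
  then have "x \<in> hull_polygon" "x \<notin> interior hull_polygon"
    using x by (auto simp: frontier_def)
  moreover have "cell f \<subseteq> interior hull_polygon" if "f \<in> faces E" for f
    using cells_subset_hull[OF _ that] cell_open_connected(1)[OF _ that] triang_edge_set[OF E]
    by (simp add: interior_maximal)
  ultimately obtain a b where ab: "(a, b) \<in> E" "x \<in> closed_segment (v a) (v b)"
    unfolding hull_decomposition[OF E] by (fastforce simp: skeleton_def chord_segment_def)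
  have "a < b" "b < m"
    using edge_setD[OF triang_edge_set[OF E] ab(1)] by auto
  consider "(a, b) \<in> sides" | "(a, b) \<in> chords m"
    using side_or_chord[OF \<open>a < b\<close> \<open>b < m\<close>] by blast
  then show "x \<in> skeleton sides"
  proof cases
    case 1
    with ab show ?thesis by (force simp: skeleton_def chord_segment_def)
  next
    case 2
    then have "x \<notin> open_segment (v a) (v b)"
      using chord_in_interior \<open>x \<notin> interior hull_polygon\<close> by blast
    then have "x = v a \<or> x = v b"
      using ab(2) by (auto simp: open_segment_def)
    moreover have "v k \<in> skeleton sides" if "k < m" for k
    proof (cases "Suc k < m")
      case True
      then have "(k, Suc k) \<in> sides" by (simp add: sides_def)
      then show ?thesis by (force simp: skeleton_def chord_segment_def)
    next
      case False
      then have "k = m - 1" using that by simp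
      then show ?thesis by (force simp: skeleton_def chord_segment_def sides_def)
    qed
    ultimately show ?thesis
      using \<open>a < b\<close> \<open>b < m\<close> by auto
  qed
qed

lemma closure_open_triangle: "closure (open_triangle v a b c) \<subseteq> convex hull {v a, v b, v c}"
  unfolding open_triangle_def
  by (intro closure_minimal interior_subset compact_imp_closed finite_imp_compact_convex_hull) simp

text \<open>
  The ends of the chord are in the closed triangle, hence corners of it because the vertices are
  extreme. So the chord is a side of the triangle, and the line through it misses the interior.
\<close>
lemma chord_not_inside_triangle:
  assumes "i < j" "j < m" "a < m" "b < m" "c < m"
  shows "\<not> open_segment (v i) (v j) \<subseteq> open_triangle v a b c"
proof
  assume sub: "open_segment (v i) (v j) \<subseteq> open_triangle v a b c"
  have ne: "v i \<noteq> v j"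
    using v_inj assms by simp
  have "closed_segment (v i) (v j) \<subseteq> closure (open_triangle v a b c)"
    using closure_mono[OF sub] ne by simp
  also have "\<dots> \<subseteq> convex hull {v a, v b, v c}"
    by (rule closure_open_triangle)
  finally have seg: "closed_segment (v i) (v j) \<subseteq> convex hull {v a, v b, v c}" .
  have "v i \<in> convex hull {v a, v b, v c}" "v j \<in> convex hull {v a, v b, v c}"
    using seg by auto
  then have "i = a \<or> i = b \<or> i = c" "j = a \<or> j = b \<or> j = c"
    using vertex_in_triangle[of i a b c] vertex_in_triangle[of j a b c] assms by auto
  then have "{a, b, c} \<in> {{i, j, a}, {i, j, b}, {i, j, c}}"
    using assms(1) by (elim disjE) (simp_all add: insert_commute)
  then obtain l where l: "l < m" "{a, b, c} = {i, j, l}"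
    using assms(3-5) by blast
  have hull: "convex hull {v a, v b, v c} = convex hull (v ` {i, j, l})"
    unfolding l(2)[symmetric] by simp
  define x where "x = (1/2) *\<^sub>R v i + (1/2) *\<^sub>R v j"
  have "x \<in> open_segment (v i) (v j)"
    unfolding x_def in_segment using ne by (auto intro!: exI[of _ "1/2"])
  then have xin: "x \<in> interior (convex hull (v ` {i, j, l}))"
    using sub hull by (auto simp: open_triangle_def)
  have x0: "orient (v i) (v j) x = 0"
    using orient_segment[of "v i" "v j" "1/2" "v i" "v j"] by (simp add: x_def)
  show False
  proof (cases "0 \<le> orient (v i) (v j) (v l)")
    case True
    have "0 \<le> orient (v i) (v j) y" if "y \<in> convex hull (v ` {i, j, l})" for y
      using that by (rule hull_orient_ge) (use True in auto)
    then show False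
      using interior_orient_pos[OF ne xin] x0 by simp
  next
    case False
    have "orient (v i) (v j) y \<le> 0" if "y \<in> convex hull (v ` {i, j, l})" for y
      using that by (rule hull_orient_le) (use False in auto)
    then show False
      using interior_orient_neg[OF ne xin] x0 by simp
  qed
qed

text \<open>
  Take a recursively built triangulation \<open>E\<close> containing the given edges. A chord of \<open>E\<close> that is
  missing in \<open>T\<close> avoids the drawing, so it runs in one region, and this region is bounded as it cannot
  leave the polygon through the sides. Then it would be an open triangle containing the chord.
\<close>
lemma triangulation_imp_triang:
  assumes "triangulation m v T"
  shows "triang (\<lambda>_ _ _. True) 0 (m - 1) (T \<union> sides)"
proof -
  have T: "T \<subseteq> chords m"
    using assms by (simp add: triangulation_def)
  note edge = edge_setD[OF edge_set_chords_sides[OF T]]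
  obtain E where E: "triang (\<lambda>_ _ _. True) 0 (m - 1) E" "T \<union> sides \<subseteq> E"
    using noncrossing_extends_to_triang[OF _ triangulation_noncrossing[OF assms], of 0 "m - 1"]
      edge m_ge_2 by fastforce
  have "E \<subseteq> T \<union> sides"
  proof (rule ccontr)
    assume "\<not> E \<subseteq> T \<union> sides"
    then obtain i j where ij: "(i, j) \<in> E" "(i, j) \<notin> T \<union> sides"
      by auto
    then have "i < j" "j < m"
      using edge_setD[OF triang_edge_set[OF E(1)]] by auto
    then have chord: "(i, j) \<in> chords m"
      using ij(2) side_or_chord by blast
    have avoid: "open_segment (v i) (v j) \<inter> drawing m v T = {}"
    proof -
      have "x \<notin> closed_segment (v a) (v b)" if x: "x \<in> open_segment (v i) (v j)" and ab: "(a, b) \<in> T \<union> sides" for x a b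
      proof
        assume "x \<in> closed_segment (v a) (v b)"
        moreover have "\<not> crossing (a, b) (i, j)" "\<not> crossing (i, j) (a, b)"
          using triang_noncrossing[OF E(1)] ij(1) ab E(2) unfolding noncrossing_def by blast+
        ultimately have "x \<in> v ` ({i, j} \<inter> {a, b})"
          using ij ab x edge[OF ab] \<open>i < j\<close> \<open>j < m\<close> open_closed_segment
          by (intro noncrossing_segments_meet_in_vertices) auto
        then show False
          using x by (auto simp: open_segment_def)
      qed
      then show ?thesis
        unfolding drawing_eq skeleton_def chord_segment_def by fastforce
    qed
    have ne: "v i \<noteq> v j"
      using v_inj \<open>i < j\<close> \<open>j < m\<close> by simp
    then obtain x where x: "x \<in> open_segment (v i) (v j)"
      by (metis ex_in_conv open_segment_eq_empty)
    define R where "R = connected_component_set (- drawing m v T) x"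
    have seg_R: "open_segment (v i) (v j) \<subseteq> R"
      unfolding R_def by (rule connected_component_maximal) (use x avoid in \<open>auto intro: convex_connected\<close>)
    have "x \<in> interior hull_polygon"
      using chord_in_interior[OF chord] x by blast
    have "R \<inter> frontier hull_polygon = {}"
    proof -
      have "R \<subseteq> - drawing m v T"
        unfolding R_def by (rule connected_component_subset)
      moreover have "skeleton sides \<subseteq> drawing m v T"
        by (auto simp: drawing_eq skeleton_def)
      ultimately show ?thesis
        using frontier_hull_subset_sides by blast
    qed
    moreover have "connected R"
      unfolding R_def by (rule connected_connected_component)
    moreover have "x \<in> R \<inter> hull_polygon"
      using x seg_R \<open>x \<in> interior hull_polygon\<close> interior_subset by blast
    ultimately have "R \<subseteq> hull_polygon"
      using connected_Int_frontier[of R hull_polygon] by auto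
    then have "bounded R"
      using bounded_hull bounded_subset by blast
    moreover have "R \<in> components (- drawing m v T)"
      unfolding R_def using x avoid by (intro componentsI) auto
    ultimately have "R \<in> bounded_regions m v T"
      by (simp add: bounded_regions_def)
    moreover have "\<forall>R\<in>bounded_regions m v T. \<exists>i<m. \<exists>j<m. \<exists>k<m. R = open_triangle v i j k"
      using assms by (simp add: triangulation_def)
    ultimately obtain a b c where abc: "a < m" "b < m" "c < m" "R = open_triangle v a b c"
      by blast
    show False
      using chord_not_inside_triangle[OF \<open>i < j\<close> \<open>j < m\<close> abc(1-3)] seg_R abc(4) by simp
  qed
  with E(2) have "E = T \<union> sides"
    by (rule equalityI[rotated])
  with E(1) show ?thesis
    by simp
qed

lemma triang_imp_triangulation:
  assumes T: "T \<subseteq> chords m" and E: "triang ok 0 (m - 1) (T \<union> sides)"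
  shows "triangulation m v T"
  unfolding triangulation_def
proof (intro conjI ballI impI T)
  fix e f assume ef: "e \<in> T" "f \<in> T" "e \<noteq> f"
  obtain a b c d where e: "e = (a, b)" and f: "f = (c, d)"
    by (cases e, cases f)
  have lt: "a < b" "b < m" "c < d" "d < m"
    using ef T e f by (auto simp: chords_def)
  have "\<not> crossing (a, b) (c, d)" "\<not> crossing (c, d) (a, b)"
    using triang_noncrossing[OF E] ef e f unfolding noncrossing_def by blast+
  then have "chord_segment v e \<inter> chord_segment v f \<subseteq> v ` ({a, b} \<inter> {c, d})"
    using noncrossing_segments_meet_in_vertices[OF lt] ef e f by (auto simp: chord_segment_def)
  then show "chord_segment v e \<inter> chord_segment v f \<inter> interior hull_polygon = {}"
    using vertex_notin_interior lt by fastforce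
next
  fix R assume "R \<in> bounded_regions m v T"
  then obtain a b c where f: "(a, b, c) \<in> faces (T \<union> sides)" and R: "R = open_triangle v a b c"
    unfolding bounded_regions_triang[OF E] by (auto simp: cell_def)
  have "a < m" "b < m" "c < m"
    using faceD[OF triang_edge_set[OF E] f] by auto
  with R show "\<exists>i<m. \<exists>j<m. \<exists>k<m. R = open_triangle v i j k"
    by blast
qed

text \<open>
  An open triangle determines its corners, so the coloring condition on regions is one on faces.
\<close>
lemma proper_iff_faces:
  assumes E: "triang ok 0 (m - 1) (T \<union> sides)"
  shows "proper m v c col T \<longleftrightarrow> (\<forall>(i, k, j)\<in>faces (T \<union> sides). {1..c} \<subseteq> {col i, col k, col j})"
proof
  assume *: "proper m v c col T"
  have "{1..c} \<subseteq> {col i, col k, col j}" if f: "(i, k, j) \<in> faces (T \<union> sides)" for i k j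
  proof -
    have "open_triangle v i k j \<in> bounded_regions m v T"
      unfolding bounded_regions_triang[OF E] using f by (force simp: cell_def)
    moreover have "i < m" "k < m" "j < m"
      using faceD[OF triang_edge_set[OF E] f] by auto
    ultimately show ?thesis
      using * unfolding proper_def by blast
  qed
  then show "\<forall>(i, k, j)\<in>faces (T \<union> sides). {1..c} \<subseteq> {col i, col k, col j}"
    by blast
next
  assume *: "\<forall>(i, k, j)\<in>faces (T \<union> sides). {1..c} \<subseteq> {col i, col k, col j}"
  show "proper m v c col T"
    unfolding proper_def
  proof (intro allI impI)
    fix i j k assume lt: "i < m" "j < m" "k < m" and "open_triangle v i j k \<in> bounded_regions m v T"
    then obtain p q r where f: "(p, q, r) \<in> faces (T \<union> sides)"
        and eq: "open_triangle v i j k = open_triangle v p q r"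
      unfolding bounded_regions_triang[OF E] by (auto simp: cell_def)
    have pqr: "p < q" "q < r" "r < m"
      using faceD[OF triang_edge_set[OF E] f] by auto
    have "convex hull {v p, v q, v r} \<subseteq> closure (open_triangle v p q r)"
      unfolding open_triangle_def
      using convex_closure_interior[OF convex_convex_hull interior_triangle_nonempty[OF left[OF pqr]]]
        closure_subset by simp
    also have "closure (open_triangle v p q r) \<subseteq> convex hull {v i, v j, v k}"
      unfolding eq[symmetric] by (rule closure_open_triangle)
    finally have sub: "convex hull {v p, v q, v r} \<subseteq> convex hull {v i, v j, v k}" .
    have "l \<in> {i, j, k}" if "l \<in> {p, q, r}" for l
    proof (rule vertex_in_triangle)
      show "v l \<in> convex hull {v i, v j, v k}"
        using that by (intro subsetD[OF sub] hull_inc) auto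
    qed (use lt pqr that in auto)
    then have "{col p, col q, col r} \<subseteq> {col i, col j, col k}"
      by blast
    moreover have "{1..c} \<subseteq> {col p, col q, col r}"
      using bspec[OF * f] by simp
    ultimately show "{1..c} \<subseteq> {col i, col j, col k}"
      by (rule subset_trans[rotated])
  qed
qed

lemma num_proper_eq_num_triang:
  "num_proper m v c col = num_triang (\<lambda>i k j. {1..c} \<subseteq> {col i, col k, col j}) 0 (m - 1)"
proof -
  define ok where "ok = (\<lambda>i k j. {1..c} \<subseteq> {col i, col k, col j})"
  have iff: "triangulation m v T \<and> proper m v c col T \<longleftrightarrow> T \<subseteq> chords m \<and> triang ok 0 (m - 1) (T \<union> sides)" for T
  proof
    assume T: "triangulation m v T \<and> proper m v c col T"
    then have E: "triang (\<lambda>_ _ _. True) 0 (m - 1) (T \<union> sides)"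
      using triangulation_imp_triang by simp
    have "T \<subseteq> chords m"
      using T by (simp add: triangulation_def)
    moreover have "\<forall>(i, k, j)\<in>faces (T \<union> sides). ok i k j"
      using T proper_iff_faces[OF E] by (simp add: ok_def)
    ultimately show "T \<subseteq> chords m \<and> triang ok 0 (m - 1) (T \<union> sides)"
      using E triang_iff_faces[of ok] by simp
  next
    assume "T \<subseteq> chords m \<and> triang ok 0 (m - 1) (T \<union> sides)"
    then have T: "T \<subseteq> chords m" and E: "triang ok 0 (m - 1) (T \<union> sides)"
      by auto
    then have "\<forall>(i, k, j)\<in>faces (T \<union> sides). ok i k j"
      using triang_iff_faces[of ok] by simp
    then show "triangulation m v T \<and> proper m v c col T"
      using triang_imp_triangulation[OF T E] proper_iff_faces[OF E] by (simp add: ok_def)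
  qed
  have disj: "chords m \<inter> sides = {}"
    by (auto simp: chords_def sides_def)
  have "bij_betw (\<lambda>T. T \<union> sides) {T. triangulation m v T \<and> proper m v c col T} {E. triang ok 0 (m - 1) E}"
  proof (rule bij_betw_byWitness[where f' = "\<lambda>E. E - sides"])
    have sides: "sides \<subseteq> E" if "triang ok 0 (m - 1) E" for E
      using triang_edge[OF that] triang_sides[OF that] by (auto simp: sides_def)
    have chords: "E - sides \<subseteq> chords m" if "triang ok 0 (m - 1) E" for E
    proof (rule subrelI)
      fix a b assume "(a, b) \<in> E - sides"
      then show "(a, b) \<in> chords m"
        using edge_setD[OF triang_edge_set[OF that], of a b] side_or_chord[of a b] by simp
    qed
    show "\<forall>T\<in>{T. triangulation m v T \<and> proper m v c col T}. T \<union> sides - sides = T"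
      using disj by (auto simp: triangulation_def)
    show "\<forall>E\<in>{E. triang ok 0 (m - 1) E}. E - sides \<union> sides = E"
      using sides by blast
    show "(\<lambda>T. T \<union> sides) ` {T. triangulation m v T \<and> proper m v c col T} \<subseteq> {E. triang ok 0 (m - 1) E}"
      using iff by auto
    show "(\<lambda>E. E - sides) ` {E. triang ok 0 (m - 1) E} \<subseteq> {T. triangulation m v T \<and> proper m v c col T}"
    proof (rule image_subsetI)
      fix E assume "E \<in> {E. triang ok 0 (m - 1) E}"
      then have "triang ok 0 (m - 1) (E - sides \<union> sides)" "E - sides \<subseteq> chords m"
        using sides[of E] chords[of E] by (auto simp: Un_absorb2)
      then show "E - sides \<in> {T. triangulation m v T \<and> proper m v c col T}"
        using iff by blast
    qed
  qed
  then have "num_proper m v c col = card {E. triang ok 0 (m - 1) E}"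
    unfolding num_proper_def by (rule bij_betw_same_card)
  then show ?thesis
    using card_triang[of ok 0 "m - 1"] by (simp add: ok_def)
qed

end

section \<open>Fuss-Catalan numbers as coefficients of powers\<close>

text \<open>
  The coefficient form of \<open>F\<^sup>d\<^sup>+\<^sup>1 = F\<^sup>d + x F\<^sup>d\<^sup>+\<^sup>k\<close>. All three numbers are rational multiples of one
  binomial coefficient \<open>M choose n\<close> with \<open>M = k (n + 1) + d - 1\<close>.
\<close>
lemma kd_catalan_rec:
  assumes "2 \<le> k"
  shows "kd_catalan (Suc n) k (Suc d) = kd_catalan (Suc n) k d + kd_catalan n k (d + k)"
proof -
  define M where "M = k * Suc n + d - 1"
  define D where "D = (real k - 1) * real (Suc n) + real d"
  have "2 * Suc n \<le> k * Suc n"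
    using assms by (intro mult_right_mono) auto
  then have M1: "M + 1 = k * Suc n + d" and Mn: "n < M"
    by (auto simp: M_def)
  have rM: "real M = real k * real (Suc n) + real d - 1"
    using M1 by (metis add_diff_cancel_right' of_nat_1 of_nat_add of_nat_mult)
  have D: "D = real M - real n" by (auto simp: D_def rM algebra_simps)
  have D0: "D > 0"
    using Mn unfolding D by simp
  define c where "c = real (M choose n)"
  have "real (Suc n) * real (M choose Suc n) = D * c"
  proof -
    have "Suc n * (M choose Suc n) = (M - n) * (M choose n)"
      by (metis binomial_absorb_comp binomial_absorption mult.commute)
    then have "real (Suc n * (M choose Suc n)) = real ((M - n) * (M choose n))"
      by simp
    then show ?thesis
      using Mn unfolding D by (simp only: of_nat_mult c_def) (simp add: of_nat_diff)
  qed
  then have b1: "real (M choose Suc n) = D * c / real (Suc n)"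
    by (simp add: field_simps)
  have b2: "real (Suc M choose Suc n) = c + D * c / real (Suc n)"
    using b1 by (simp add: c_def)
  have e1: "kd_catalan (Suc n) k (Suc d) = (real d + 1) / (D + 1) * real (Suc M choose Suc n)"
  proof -
    have "k * Suc n + Suc d - 1 = Suc M" using M1 by simp
    then show ?thesis unfolding kd_catalan_def D_def by (simp add: add.commute)
  qed
  have e2: "kd_catalan (Suc n) k d = real d / D * real (M choose Suc n)"
    unfolding kd_catalan_def D_def M_def ..
  have e3: "kd_catalan n k (d + k) = (real d + real k) / (D + 1) * c"
  proof -
    have "k * n + (d + k) - 1 = M" by (simp add: M_def algebra_simps)
    moreover have "(real k - 1) * real n + real (d + k) = D + 1"
      by (simp add: D_def algebra_simps)
    ultimately show ?thesis unfolding kd_catalan_def c_def by simp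
  qed
  have k: "real k = (D + 1 + real n - real d) / real (Suc n)"
    using D rM by (simp add: field_simps)
  have "D + 1 \<noteq> 0" "D \<noteq> 0" "real (Suc n) \<noteq> 0"
    using D0 by auto
  then show ?thesis
    unfolding e1 e2 e3 b1 b2 k by (simp add: divide_simps) (simp add: algebra_simps)
qed

text \<open>
  The recurrence determines the coefficients of all powers from the constant coefficient \<open>1\<close>, by
  induction on \<open>n\<close> and, inside, on \<open>d\<close>. The inner induction starts at \<open>F\<^sup>0\<close>, where
  both sides vanish because \<open>n\<close> is positive there.
\<close>
lemma fps_power_nth_kd_catalan:
  fixes F :: "real fps"
  assumes k: "2 \<le> k" and F: "F = 1 + fps_const t * fps_X * F ^ k"
  shows "fps_nth (F ^ Suc d) n = t ^ n * kd_catalan n k (Suc d)"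
proof (induction n arbitrary: d)
  case 0
  have "fps_nth F 0 = 1"
    by (subst F) simp
  then show ?case
    by (simp add: kd_catalan_def fps_nth_power_0 del: power_Suc)
next
  case (Suc n)
  have step: "fps_nth (F ^ Suc d) (Suc n) = fps_nth (F ^ d) (Suc n) + t ^ Suc n * kd_catalan n k (d + k)" for d
  proof -
    have "F ^ Suc d = F ^ d * (1 + fps_const t * fps_X * F ^ k)"
      using F by simp
    also have "\<dots> = F ^ d + fps_X * (fps_const t * F ^ (d + k))"
      by (simp add: algebra_simps power_add)
    finally have "fps_nth (F ^ Suc d) (Suc n) = fps_nth (F ^ d) (Suc n) + t * fps_nth (F ^ (d + k)) n"
      by simp
    moreover have "fps_nth (F ^ (d + k)) n = t ^ n * kd_catalan n k (d + k)"
      using Suc[of "d + k - 1"] k by simp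
    ultimately show ?thesis by simp
  qed
  have "fps_nth (F ^ d) (Suc n) = t ^ Suc n * kd_catalan (Suc n) k d" for d
  proof (induction d)
    case 0
    then show ?case by (simp add: kd_catalan_def)
  next
    case (Suc d)
    then show ?case
      unfolding step by (simp only: kd_catalan_rec[OF k]) (simp add: algebra_simps)
  qed
  then show ?case .
qed

lemma fps_mult_sum_atMost:
  fixes F G :: "real fps"
  shows "fps_nth (F * G) n = (\<Sum>p\<le>n. fps_nth F p * fps_nth G (n - p))"
  by (simp add: fps_mult_nth atLeast0AtMost)

text \<open>
  The coloring conditions on an apex are congruences; this turns sums over apices into
  coefficients of products of power series.
\<close>
lemma sum_residue_class:
  fixes i j q r n :: nat
  assumes "0 < r" "r < q" "i + q * n + r < j" "j \<le> i + q * Suc n + r"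
  shows "sum f {k. i < k \<and> k < j \<and> (k - i) mod q = r} = (\<Sum>p\<le>n. f (i + q * p + r))"
proof (rule sum.reindex_bij_witness[of _ "\<lambda>p. i + q * p + r" "\<lambda>k. (k - i) div q"])
  fix k assume k: "k \<in> {k. i < k \<and> k < j \<and> (k - i) mod q = r}"
  then have eq: "k - i = q * ((k - i) div q) + r"
    using mult_div_mod_eq[of q "k - i"] by simp
  then show k_eq: "i + q * ((k - i) div q) + r = k"
    using k by auto
  have "i < k" "k < j"
    using k by auto
  then have "q * ((k - i) div q) < q * Suc n"
    using eq assms(4) by linarith
  then show "(k - i) div q \<in> {..n}"
    by (simp only: mult_less_cancel1 atMost_iff) simp
  show "f (i + q * ((k - i) div q) + r) = f k"
    by (simp only: k_eq)
next
  fix p assume "p \<in> {..n}"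
  then have "q * p \<le> q * n"
    by simp
  then have "i + q * p + r < j"
    using assms(3) by linarith
  then show "i + q * p + r \<in> {k. i < k \<and> k < j \<and> (k - i) mod q = r}"
    using assms(1,2) by simp
  show "(i + q * p + r - i) div q = p"
    using assms by simp
qed

section \<open>Two colors\<close>

definition bicolored :: "nat \<Rightarrow> nat \<Rightarrow> nat \<Rightarrow> bool" where
  "bicolored i k j \<longleftrightarrow> {1..2} \<subseteq> {color2 i, color2 k, color2 j}"

lemma bicolored_iff: "bicolored i k j \<longleftrightarrow> \<not> (even i = even k \<and> even k = even j)"
proof -
  have "{1..2::nat} = {1, 2}"
    by auto
  moreover have "color2 l = (if even l then 1 else 2)" for l
    by (simp add: color2_def odd_iff_mod_2_eq_one)
  ultimately show ?thesis
    by (simp add: bicolored_def)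
qed

lemma num_triang_bicolored_shift:
  "i \<le> j \<Longrightarrow> num_triang bicolored i j = num_triang bicolored 0 (j - i)"
  using num_triang_shift[of 0 "j - i" bicolored i bicolored] by (auto simp: bicolored_iff)

lemma num_triang_bicolored_even:
  "num_triang bicolored 0 (2 * n + 2) =
    (\<Sum>p\<le>n. num_triang bicolored 0 (2 * p + 1) * num_triang bicolored 0 (2 * (n - p) + 1))"
proof -
  let ?f = "\<lambda>k. num_triang bicolored 0 k * num_triang bicolored k (2 * n + 2)"
  have "num_triang bicolored 0 (2 * n + 2) =
      sum ?f {k. 0 < k \<and> k < 2 * n + 2 \<and> bicolored 0 k (2 * n + 2)}"
    by (rule num_triang_rec) simp
  also have "\<dots> = sum ?f {k. 0 < k \<and> k < 2 * n + 2 \<and> (k - 0) mod 2 = 1}"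
    by (rule arg_cong[where f = "sum ?f"]) (auto simp: bicolored_iff odd_iff_mod_2_eq_one)
  also have "\<dots> = (\<Sum>p\<le>n. ?f (0 + 2 * p + 1))"
    by (rule sum_residue_class) auto
  also have "\<dots> = (\<Sum>p\<le>n. num_triang bicolored 0 (2 * p + 1) * num_triang bicolored 0 (2 * (n - p) + 1))"
  proof (rule sum.cong)
    fix p assume "p \<in> {..n}"
    then have "2 * n + 2 - (2 * p + 1) = 2 * (n - p) + 1"
      by auto
    then show "?f (0 + 2 * p + 1) = num_triang bicolored 0 (2 * p + 1) * num_triang bicolored 0 (2 * (n - p) + 1)"
      using num_triang_bicolored_shift[of "2 * p + 1" "2 * n + 2"] \<open>p \<in> {..n}\<close> by simp
  qed simp
  finally show ?thesis .
qed

text \<open>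
  Here the ends have different colors, so every apex is admissible. Odd and even apices contribute
  the same amount by reflection.
\<close>
lemma num_triang_bicolored_odd:
  "num_triang bicolored 0 (2 * Suc n + 1) =
    2 * (\<Sum>p\<le>n. num_triang bicolored 0 (2 * p + 1) * num_triang bicolored 0 (2 * (n - p) + 2))"
proof -
  let ?N = "2 * Suc n + 1"
  let ?f = "\<lambda>k. num_triang bicolored 0 k * num_triang bicolored 0 (?N - k)"
  let ?S = "\<Sum>p\<le>n. num_triang bicolored 0 (2 * p + 1) * num_triang bicolored 0 (2 * (n - p) + 2)"
  have "num_triang bicolored 0 ?N =
      (\<Sum>k | 0 < k \<and> k < ?N \<and> bicolored 0 k ?N. num_triang bicolored 0 k * num_triang bicolored k ?N)"
    by (rule num_triang_rec) simp
  also have "\<dots> = sum ?f {0<..<?N}"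
  proof (rule sum.cong)
    show "{k. 0 < k \<and> k < ?N \<and> bicolored 0 k ?N} = {0<..<?N}"
      by (auto simp: bicolored_iff)
    show "num_triang bicolored 0 k * num_triang bicolored k ?N = ?f k" if "k \<in> {0<..<?N}" for k
      using that num_triang_bicolored_shift[of k ?N] by simp
  qed
  also have "{0<..<?N} = {k \<in> {0<..<?N}. odd k} \<union> {k \<in> {0<..<?N}. even k}"
    by auto
  also have "sum ?f \<dots> = sum ?f {k \<in> {0<..<?N}. odd k} + sum ?f {k \<in> {0<..<?N}. even k}"
    by (rule sum.union_disjoint) auto
  also have "sum ?f {k \<in> {0<..<?N}. odd k} = ?S"
  proof (rule sum.reindex_bij_witness[of _ "\<lambda>p. 2 * p + 1" "\<lambda>k. k div 2"])
    fix k assume k: "k \<in> {k \<in> {0<..<?N}. odd k}"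
    then obtain p where p: "k = 2 * p + 1"
      by (auto elim: oddE)
    then have "?N - k = 2 * (n - p) + 2"
      using k by auto
    then show "num_triang bicolored 0 (2 * (k div 2) + 1) * num_triang bicolored 0 (2 * (n - k div 2) + 2) = ?f k"
      using p by simp
    show "2 * (k div 2) + 1 = k" "k div 2 \<in> {..n}"
      using p k by auto
  qed auto
  also have "sum ?f {k \<in> {0<..<?N}. even k} = ?S"
  proof (rule sum.reindex_bij_witness[of _ "\<lambda>p. ?N - (2 * p + 1)" "\<lambda>k. (?N - k) div 2"])
    fix k assume k: "k \<in> {k \<in> {0<..<?N}. even k}"
    then obtain q where q: "k = 2 * q"
      by (auto elim: evenE)
    define p where "p = Suc n - q"
    have p: "?N - k = 2 * p + 1" "p \<le> n" "k = 2 * (n - p) + 2"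
      using k q by (auto simp: p_def)
    then show "num_triang bicolored 0 (2 * ((?N - k) div 2) + 1) *
        num_triang bicolored 0 (2 * (n - (?N - k) div 2) + 2) = ?f k"
      by simp
    show "?N - (2 * ((?N - k) div 2) + 1) = k" "(?N - k) div 2 \<in> {..n}"
      using p by auto
  qed auto
  finally show ?thesis by simp
qed

lemma num_triang_bicolored:
  "real (num_triang bicolored 0 (2 * n + 1)) = 2 ^ n * kd_catalan n 3 1"
  "real (num_triang bicolored 0 (2 * n + 2)) = 2 ^ n * kd_catalan n 3 2"
proof -
  define D where "D = Abs_fps (\<lambda>n. real (num_triang bicolored 0 (2 * n + 1)))"
  define E where "E = Abs_fps (\<lambda>n. real (num_triang bicolored 0 (2 * n + 2)))"
  have E: "E = D ^ 2"
  proof (rule fps_ext)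
    fix n
    show "fps_nth E n = fps_nth (D ^ 2) n"
      unfolding power2_eq_square fps_mult_sum_atMost E_def D_def fps_nth_Abs_fps num_triang_bicolored_even by simp
  qed
  have "D = 1 + fps_const 2 * fps_X * (D * E)"
  proof (rule fps_ext)
    fix n
    show "fps_nth D n = fps_nth (1 + fps_const 2 * fps_X * (D * E)) n"
    proof (cases n)
      case 0
      then show ?thesis
        using num_triang_edge[of bicolored 0] by (simp add: D_def)
    next
      case (Suc n)
      have "fps_nth (1 + fps_const 2 * fps_X * (D * E)) (Suc n) = 2 * fps_nth (D * E) n"
        by (simp add: mult.assoc)
      also have "\<dots> = fps_nth D (Suc n)"
        unfolding fps_mult_sum_atMost E_def D_def fps_nth_Abs_fps num_triang_bicolored_odd by simp
      finally show ?thesis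
        using Suc by simp
    qed
  qed
  then have D: "D = 1 + fps_const 2 * fps_X * D ^ 3"
    by (simp add: E power2_eq_square power3_eq_cube mult.assoc)
  show "real (num_triang bicolored 0 (2 * n + 1)) = 2 ^ n * kd_catalan n 3 1"
    using fps_power_nth_kd_catalan[OF _ D, of 0 n] by (simp add: D_def)
  show "real (num_triang bicolored 0 (2 * n + 2)) = 2 ^ n * kd_catalan n 3 2"
    using fps_power_nth_kd_catalan[OF _ D, of 1 n] by (simp add: E[symmetric] numeral_2_eq_2[symmetric]) (simp add: E_def)
qed

section \<open>Three colors\<close>

definition tricolored :: "nat \<Rightarrow> nat \<Rightarrow> nat \<Rightarrow> bool" where
  "tricolored i k j \<longleftrightarrow> i mod 3 \<noteq> k mod 3 \<and> k mod 3 \<noteq> j mod 3 \<and> i mod 3 \<noteq> j mod 3"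

lemma three_colors_iff:
  fixes a b c :: nat
  assumes "a < 3" "b < 3" "c < 3"
  shows "{1..3} \<subseteq> {a + 1, b + 1, c + 1} \<longleftrightarrow> a \<noteq> b \<and> b \<noteq> c \<and> a \<noteq> c"
proof -
  have "{1..3::nat} = {1, 2, 3}"
    by auto
  moreover have "a = 0 \<or> a = 1 \<or> a = 2" "b = 0 \<or> b = 1 \<or> b = 2" "c = 0 \<or> c = 1 \<or> c = 2"
    using assms by auto
  ultimately show ?thesis
    by (elim disjE) simp_all
qed

lemma mod_3_add_right_cancel:
  "((a + s) mod 3 = (b + s) mod 3) = (a mod 3 = b mod 3)" for a b s :: nat
  unfolding nat_mod_eq_iff by (simp add: add.assoc add.left_commute[of _ s])

text \<open>
  A rotation of the colors does not change which triangles are admissible.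
\<close>
lemma num_triang_tricolored_shift:
  assumes "i \<le> j"
  shows "num_triang tricolored i j = num_triang tricolored 0 (j - i)"
proof -
  have "num_triang tricolored (0 + i) (j - i + i) = num_triang tricolored 0 (j - i)"
    by (rule num_triang_shift) (simp only: tricolored_def mod_3_add_right_cancel)
  with assms show ?thesis by simp
qed

lemma num_triang_tricolored_2:
  "num_triang tricolored 0 (3 * n + 2) =
    (\<Sum>p\<le>n. num_triang tricolored 0 (3 * p + 1) * num_triang tricolored 0 (3 * (n - p) + 1))"
proof -
  let ?L = "3 * n + 2"
  let ?f = "\<lambda>k. num_triang tricolored 0 k * num_triang tricolored k ?L"
  have "num_triang tricolored 0 ?L = sum ?f {k. 0 < k \<and> k < ?L \<and> tricolored 0 k ?L}"
    by (rule num_triang_rec) simp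
  also have "{k. 0 < k \<and> k < ?L \<and> tricolored 0 k ?L} = {k. 0 < k \<and> k < ?L \<and> (k - 0) mod 3 = 1}"
  proof (rule Collect_cong)
    fix k :: nat
    have "k mod 3 = 0 \<or> k mod 3 = 1 \<or> k mod 3 = 2" "?L mod 3 = 2"
      by presburger+
    then show "(0 < k \<and> k < ?L \<and> tricolored 0 k ?L) = (0 < k \<and> k < ?L \<and> (k - 0) mod 3 = 1)"
      unfolding tricolored_def by (elim disjE) (simp_all del: mult_Suc_right)
  qed
  also have "sum ?f \<dots> = (\<Sum>p\<le>n. ?f (0 + 3 * p + 1))"
    by (rule sum_residue_class) auto
  also have "\<dots> = (\<Sum>p\<le>n. num_triang tricolored 0 (3 * p + 1) * num_triang tricolored 0 (3 * (n - p) + 1))"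
  proof (rule sum.cong)
    fix p assume "p \<in> {..n}"
    then have "?L - (3 * p + 1) = 3 * (n - p) + 1"
      by auto
    then show "?f (0 + 3 * p + 1) = num_triang tricolored 0 (3 * p + 1) * num_triang tricolored 0 (3 * (n - p) + 1)"
      using num_triang_tricolored_shift[of "3 * p + 1" ?L] \<open>p \<in> {..n}\<close> by simp
  qed simp
  finally show ?thesis .
qed

lemma num_triang_tricolored_1:
  "num_triang tricolored 0 (3 * Suc n + 1) =
    (\<Sum>p\<le>n. num_triang tricolored 0 (3 * p + 2) * num_triang tricolored 0 (3 * (n - p) + 2))"
proof -
  let ?L = "3 * Suc n + 1"
  let ?f = "\<lambda>k. num_triang tricolored 0 k * num_triang tricolored k ?L"
  have "num_triang tricolored 0 ?L = sum ?f {k. 0 < k \<and> k < ?L \<and> tricolored 0 k ?L}"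
    by (rule num_triang_rec) simp
  also have "{k. 0 < k \<and> k < ?L \<and> tricolored 0 k ?L} = {k. 0 < k \<and> k < ?L \<and> (k - 0) mod 3 = 2}"
  proof (rule Collect_cong)
    fix k :: nat
    have "k mod 3 = 0 \<or> k mod 3 = 1 \<or> k mod 3 = 2" "?L mod 3 = 1"
      by presburger+
    then show "(0 < k \<and> k < ?L \<and> tricolored 0 k ?L) = (0 < k \<and> k < ?L \<and> (k - 0) mod 3 = 2)"
      unfolding tricolored_def by (elim disjE) (simp_all del: mult_Suc_right)
  qed
  also have "sum ?f \<dots> = (\<Sum>p\<le>n. ?f (0 + 3 * p + 2))"
    by (rule sum_residue_class) auto
  also have "\<dots> = (\<Sum>p\<le>n. num_triang tricolored 0 (3 * p + 2) * num_triang tricolored 0 (3 * (n - p) + 2))"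
  proof (rule sum.cong)
    fix p assume "p \<in> {..n}"
    then have "?L - (3 * p + 2) = 3 * (n - p) + 2"
      by auto
    then show "?f (0 + 3 * p + 2) = num_triang tricolored 0 (3 * p + 2) * num_triang tricolored 0 (3 * (n - p) + 2)"
      using num_triang_tricolored_shift[of "3 * p + 2" ?L] \<open>p \<in> {..n}\<close> by simp
  qed simp
  finally show ?thesis .
qed

text \<open>
  The generating function \<open>X\<close> for polygons with \<open>3 n + 2\<close> vertices.
\<close>
definition tri_fps :: "real fps" where
  "tri_fps = Abs_fps (\<lambda>n. real (num_triang tricolored 0 (3 * n + 1)))"

lemma tri_fps_nth: "fps_nth tri_fps n = real (num_triang tricolored 0 (3 * n + 1))"
  by (simp add: tri_fps_def)

lemma tri_fps_square_nth: "fps_nth (tri_fps ^ 2) n = real (num_triang tricolored 0 (3 * n + 2))"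
  unfolding power2_eq_square fps_mult_sum_atMost tri_fps_nth num_triang_tricolored_2 by simp

lemma tri_fps_nth_Suc: "fps_nth tri_fps (Suc n) = fps_nth (tri_fps ^ 4) n"
proof -
  have "tri_fps ^ 4 = tri_fps ^ 2 * tri_fps ^ 2"
    by (simp flip: power_add)
  then show ?thesis
    by (simp only: fps_mult_sum_atMost tri_fps_square_nth) (simp only: tri_fps_nth num_triang_tricolored_1, simp)
qed

lemma tri_fps_eq: "tri_fps = 1 + fps_const 1 * fps_X * tri_fps ^ 4"
proof (rule fps_ext)
  fix n
  show "fps_nth tri_fps n = fps_nth (1 + fps_const 1 * fps_X * tri_fps ^ 4) n"
  proof (cases n)
    case 0
    then show ?thesis
      using num_triang_edge[of tricolored 0] by (simp add: tri_fps_nth)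
  qed (simp add: tri_fps_nth_Suc)
qed

lemma tri_fps_power_nth: "fps_nth (tri_fps ^ Suc d) n = kd_catalan n 4 (Suc d)"
  using fps_power_nth_kd_catalan[OF _ tri_fps_eq, of d n] by simp

definition rainbow :: "nat \<Rightarrow> nat \<Rightarrow> nat \<Rightarrow> nat \<Rightarrow> bool" where
  "rainbow m i k j \<longleftrightarrow> {1..3} \<subseteq> {color3 m i, color3 m k, color3 m j}"

lemma rainbow_iff:
  "rainbow m i k j \<longleftrightarrow> (let c = (\<lambda>l. if m mod 3 = 1 \<and> l = m - 1 then 1 else l mod 3)
    in c i \<noteq> c k \<and> c k \<noteq> c j \<and> c i \<noteq> c j)"
proof -
  define c :: "nat \<Rightarrow> nat" where "c = (\<lambda>l. if m mod 3 = 1 \<and> l = m - 1 then 1 else l mod 3)"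
  have "color3 m l = c l + 1" "c l < 3" for l
    by (simp_all add: c_def color3_def)
  then show ?thesis
    unfolding rainbow_def Let_def c_def[symmetric] using three_colors_iff by simp
qed

lemma rainbow_eq_tricolored: "m mod 3 \<noteq> 1 \<Longrightarrow> rainbow m = tricolored"
  by (intro ext) (simp add: rainbow_iff tricolored_def)

lemma num_triang_rainbow_below_last:
  assumes "i \<le> k" "k < m - 1"
  shows "num_triang (rainbow m) i k = num_triang tricolored 0 (k - i)"
proof -
  have "num_triang (rainbow m) (0 + i) (k - i + i) = num_triang tricolored 0 (k - i)"
  proof (rule num_triang_shift)
    fix a b c assume "a < b" "b < c" "c \<le> k - i"
    then have "a + i \<noteq> m - 1" "b + i \<noteq> m - 1" "c + i \<noteq> m - 1"
      using assms by linarith+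
    then show "rainbow m (a + i) (b + i) (c + i) = tricolored a b c"
      unfolding rainbow_iff tricolored_def Let_def
      by (simp only: simp_thms if_False mod_3_add_right_cancel)
  qed
  with assms show ?thesis by simp
qed

text \<open>
  From here on, \<open>J\<close> is the last vertex, recolored from color 1 to color 2. Let \<open>Z\<close> count the polygons
  on \<open>i, \<dots>, J\<close> whose first vertex has color 1, and \<open>W\<close> those whose first vertex has color 3. The apex of
  the former has color 3, so \<open>Z = Y W\<close>; the induction hypothesis \<open>W = X\<close>, for the indices that occur
  here, gives \<open>Z = X\<^sup>3\<close>.
\<close>
lemma num_triang_rainbow_last_0:
  assumes J: "J mod 3 = 0" and i: "i + 3 * s + 3 = J"
    and IH: "\<And>q i. q \<le> s \<Longrightarrow> i + 3 * q + 1 = J \<Longrightarrow> real (num_triang (rainbow (Suc J)) i J) = fps_nth tri_fps q"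
  shows "real (num_triang (rainbow (Suc J)) i J) = fps_nth (tri_fps ^ 3) s"
proof -
  let ?R = "rainbow (Suc J)"
  let ?f = "\<lambda>k. num_triang ?R i k * num_triang ?R k J"
  have "num_triang ?R i J = sum ?f {k. i < k \<and> k < J \<and> ?R i k J}"
    using i by (intro num_triang_rec) auto
  also have "{k. i < k \<and> k < J \<and> ?R i k J} = {k. i < k \<and> k < J \<and> (k - i) mod 3 = 2}"
  proof (rule Collect_cong)
    fix k
    have "Suc J mod 3 = 1" and "i mod 3 = 0"
      using J i by presburger+
    then have "?R i k J \<longleftrightarrow> k mod 3 = 2" if "i < k" "k < J"
      using that mod_less_divisor[of 3 k] by (auto simp: rainbow_iff)
    moreover have "k mod 3 = (i mod 3 + (k - i)) mod 3" if "i < k"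
      using that by (simp only: mod_add_left_eq) simp
    then have "(k - i) mod 3 = 2 \<longleftrightarrow> k mod 3 = 2" if "i < k"
      using that \<open>i mod 3 = 0\<close> by simp
    ultimately show "(i < k \<and> k < J \<and> ?R i k J) = (i < k \<and> k < J \<and> (k - i) mod 3 = 2)"
      by blast
  qed
  also have "sum ?f \<dots> = (\<Sum>p\<le>s. ?f (i + 3 * p + 2))"
    by (rule sum_residue_class) (use i in auto)
  finally have "real (num_triang ?R i J) = (\<Sum>p\<le>s. real (?f (i + 3 * p + 2)))"
    by simp
  also have "\<dots> = (\<Sum>p\<le>s. fps_nth (tri_fps ^ 2) p * fps_nth tri_fps (s - p))"
  proof (rule sum.cong)
    fix p assume p: "p \<in> {..s}"
    have "num_triang ?R i (i + 3 * p + 2) = num_triang tricolored 0 (3 * p + 2)"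
      using num_triang_rainbow_below_last[of i "i + 3 * p + 2" "Suc J"] p i by simp
    moreover have "real (num_triang ?R (i + 3 * p + 2) J) = fps_nth tri_fps (s - p)"
      using p i by (intro IH) auto
    ultimately show "real (?f (i + 3 * p + 2)) = fps_nth (tri_fps ^ 2) p * fps_nth tri_fps (s - p)"
      by (simp add: tri_fps_square_nth)
  qed simp
  also have "\<dots> = fps_nth (tri_fps ^ 2 * tri_fps) s"
    by (simp only: fps_mult_sum_atMost)
  also have "tri_fps ^ 2 * tri_fps = tri_fps ^ 3"
    by (simp add: power2_eq_square power3_eq_cube)
  finally show ?thesis .
qed

text \<open>
  The polygons counted by \<open>W\<close> have an apex of color 1, so \<open>W = 1 + x X Z\<close>. Together with
  \<open>Z = X\<^sup>2 W\<close> this is the equation \<open>X = 1 + x X\<^sup>3 X\<close> that \<open>X\<close> satisfies, hence \<open>W = X\<close>.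
\<close>
lemma num_triang_rainbow_last_2:
  assumes J: "J mod 3 = 0" and i: "i + 3 * q + 1 = J"
  shows "real (num_triang (rainbow (Suc J)) i J) = fps_nth tri_fps q"
  using i
proof (induction q arbitrary: i rule: less_induct)
  case (less q)
  let ?R = "rainbow (Suc J)"
  show ?case
  proof (cases q)
    case 0
    then have "J = Suc i"
      using less.prems by simp
    then show ?thesis
      using 0 num_triang_edge[of tricolored 0] by (simp add: tri_fps_nth)
  next
    case (Suc r)
    let ?f = "\<lambda>k. num_triang ?R i k * num_triang ?R k J"
    have "num_triang ?R i J = sum ?f {k. i < k \<and> k < J \<and> ?R i k J}"
      using less.prems Suc by (intro num_triang_rec) auto
    also have "{k. i < k \<and> k < J \<and> ?R i k J} = {k. i < k \<and> k < J \<and> (k - i) mod 3 = 1}"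
    proof (rule Collect_cong)
      fix k
      have "Suc J mod 3 = 1" and "i mod 3 = 2"
        using J less.prems by presburger+
      then have "?R i k J \<longleftrightarrow> k mod 3 = 0" if "i < k" "k < J"
        using that mod_less_divisor[of 3 k] by (auto simp: rainbow_iff)
      moreover have "k mod 3 = (i mod 3 + (k - i)) mod 3" if "i < k"
        using that by (simp only: mod_add_left_eq) simp
      moreover have "(2 + t) mod 3 = 0 \<longleftrightarrow> t mod 3 = 1" for t :: nat
        by presburger
      ultimately have "?R i k J \<longleftrightarrow> (k - i) mod 3 = 1" if "i < k" "k < J"
        using that \<open>i mod 3 = 2\<close> by simp
      then show "(i < k \<and> k < J \<and> ?R i k J) = (i < k \<and> k < J \<and> (k - i) mod 3 = 1)"
        by blast
    qed
    also have "sum ?f \<dots> = (\<Sum>p\<le>r. ?f (i + 3 * p + 1))"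
      by (rule sum_residue_class) (use less.prems Suc in auto)
    finally have "real (num_triang ?R i J) = (\<Sum>p\<le>r. real (?f (i + 3 * p + 1)))"
      by simp
    also have "\<dots> = (\<Sum>p\<le>r. fps_nth tri_fps p * fps_nth (tri_fps ^ 3) (r - p))"
    proof (rule sum.cong)
      fix p assume p: "p \<in> {..r}"
      have "num_triang ?R i (i + 3 * p + 1) = num_triang tricolored 0 (3 * p + 1)"
        using num_triang_rainbow_below_last[of i "i + 3 * p + 1" "Suc J"] p less.prems Suc by simp
      moreover have "real (num_triang ?R (i + 3 * p + 1) J) = fps_nth (tri_fps ^ 3) (r - p)"
      proof (rule num_triang_rainbow_last_0[OF J])
        show "i + 3 * p + 1 + 3 * (r - p) + 3 = J"
          using p less.prems Suc by auto
        show "real (num_triang ?R i' J) = fps_nth tri_fps q'" if "q' \<le> r - p" "i' + 3 * q' + 1 = J" for q' i'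
          using less.IH[of q' i'] that Suc by simp
      qed
      ultimately show "real (?f (i + 3 * p + 1)) = fps_nth tri_fps p * fps_nth (tri_fps ^ 3) (r - p)"
        by (simp add: tri_fps_nth)
    qed simp
    also have "\<dots> = fps_nth (tri_fps * tri_fps ^ 3) r"
      by (simp only: fps_mult_sum_atMost)
    also have "tri_fps * tri_fps ^ 3 = tri_fps ^ 4"
      by (simp flip: power_Suc)
    finally show ?thesis
      using Suc by (simp add: tri_fps_nth_Suc)
  qed
qed

lemma num_triang_rainbow:
  "real (num_triang (rainbow (3 * n + 2)) 0 (3 * n + 1)) = kd_catalan n 4 1"
  "real (num_triang (rainbow (3 * n + 3)) 0 (3 * n + 2)) = kd_catalan n 4 2"
  "real (num_triang (rainbow (3 * n + 4)) 0 (3 * n + 3)) = kd_catalan n 4 3"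
proof -
  have "(3 * n + 2) mod 3 \<noteq> 1" "(3 * n + 3) mod 3 \<noteq> 1"
    by presburger+
  note ordinary = this[THEN rainbow_eq_tricolored]
  show "real (num_triang (rainbow (3 * n + 2)) 0 (3 * n + 1)) = kd_catalan n 4 1"
    unfolding ordinary tri_fps_nth[symmetric] using tri_fps_power_nth[of 0 n] by simp
  show "real (num_triang (rainbow (3 * n + 3)) 0 (3 * n + 2)) = kd_catalan n 4 2"
    unfolding ordinary tri_fps_square_nth[symmetric] using tri_fps_power_nth[of 1 n]
    by (simp only: Suc_1)
  have "real (num_triang (rainbow (Suc (3 * n + 3))) 0 (3 * n + 3)) = fps_nth (tri_fps ^ 3) n"
  proof (rule num_triang_rainbow_last_0)
    show J: "(3 * n + 3) mod 3 = 0" "0 + 3 * n + 3 = 3 * n + 3"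
      by simp_all
    show "real (num_triang (rainbow (Suc (3 * n + 3))) i (3 * n + 3)) = fps_nth tri_fps q"
      if "i + 3 * q + 1 = 3 * n + 3" for q i
      by (rule num_triang_rainbow_last_2[OF J(1) that])
  qed
  moreover have "Suc (3 * n + 3) = 3 * n + 4" and three: "Suc 2 = (3::nat)"
    by simp_all
  ultimately show "real (num_triang (rainbow (3 * n + 4)) 0 (3 * n + 3)) = kd_catalan n 4 3"
    using tri_fps_power_nth[of 2 n, unfolded three] by simp
qed

theorem theorem2p5:
  fixes n :: nat
  shows "(\<forall>d\<in>{1, 2::nat}. \<forall>v. convex_polygon ((2 * n + d - 1) + 2) v \<longrightarrow>
            real (a_num v (2 * n + d - 1)) = 2 ^ n * kd_catalan n 3 d) \<and>
         (\<forall>d\<in>{1, 2, 3::nat}. \<forall>v. convex_polygon ((3 * n + d - 1) + 2) v \<longrightarrow>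
            real (b_num v (3 * n + d - 1)) = kd_catalan n 4 d)"
proof (intro conjI ballI allI impI)
  fix d :: nat and v
  assume d: "d \<in> {1, 2}" and v: "convex_polygon ((2 * n + d - 1) + 2) v"
  have "(2 * n + d - 1) + 2 - 1 = 2 * n + d"
    using d by auto
  then have "a_num v (2 * n + d - 1) = num_triang bicolored 0 (2 * n + d)"
    unfolding a_num_def polygon.num_proper_eq_num_triang[OF polygon.intro[OF v]] bicolored_def[abs_def]
    by simp
  then show "real (a_num v (2 * n + d - 1)) = 2 ^ n * kd_catalan n 3 d"
    using d num_triang_bicolored[of n] by auto
next
  fix d :: nat and v
  assume d: "d \<in> {1, 2, 3}" and v: "convex_polygon ((3 * n + d - 1) + 2) v"
  have m: "(3 * n + d - 1) + 2 = 3 * n + d + 1" "3 * n + d + 1 - 1 = 3 * n + d"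
    using d by auto
  have "b_num v (3 * n + d - 1) = num_triang (rainbow (3 * n + d + 1)) 0 (3 * n + d)"
    using polygon.num_proper_eq_num_triang[OF polygon.intro[OF v], of 3 "color3 (3 * n + d - 1 + 2)"]
    unfolding b_num_def rainbow_def[abs_def] by (simp only: m)
  moreover have "3 * n + 1 + 1 = 3 * n + 2" "3 * n + 2 + 1 = 3 * n + 3" "3 * n + 3 + 1 = 3 * n + 4"
    by simp_all
  then have "real (num_triang (rainbow (3 * n + d + 1)) 0 (3 * n + d)) = kd_catalan n 4 d"
    using d by (elim insertE emptyE) (simp_all only: num_triang_rainbow)
  ultimately show "real (b_num v (3 * n + d - 1)) = kd_catalan n 4 d"
    by simp
qed

end
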